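(* Let $n\ge 3$ and let $x\in S^n$ be a $\frac12$-integer point with support graph $G_x$. Suppose that (A) $G_x$ has a Hamiltonian cycle $H$, and (B) $x$ is a convex combination of incidence vectors of $1$-trees of $K_n$ each of which contains an even number of edges of every cut $\delta_{G_x}(S)$ ($\emptyset\ne S\subsetneq V_n$) of $G_x$ that consists of exactly four $\frac12$-edges, all belonging to $H$. Then $\frac{10}{7}x\in T^n$.
   Context: $K_n=(V_n,E_n)$ is the complete graph on $n$ nodes, one of which is labelled $1$. For $U\subseteq V_n$, $\delta(U)$ is the set of edges with exactly one endpoint in $U$ (and $\delta_{G}(U)$ the same within a graph $G$), $x(F)=\sum_{e\in F}x_e$. $S^n=\{x\in\mathbb{R}^{E_n}: x(\delta(v))=2 \ \forall v,\ x(\delta(S))\ge 2\ \forall \emptyset\ne S\subsetneq V_n,\ 0\le x\le 1\}$. The support graph of $x$ is $G_x=(V_n,\{e: x_e>0\})$. A point $x\in S^n$ is $\frac12$-integer if $x_e\in\{0,\frac12,1\}$ for all $e$; edges with $x_e=\frac12$ are $\frac12$-edges. A $1$-tree is an edge set $F\subseteq E_n$ with $|F\cap\delta(1)|=2$ such that $F\setminus\delta(1)$ is a spanning tree on $V_n\setminus\{1\}$. A tour is a multiset $J$ of edges of $K_n$ such that $(V_n,J)$ is connected with all degrees even; $\chi^J$ records multiplicities; $T^n$ is the convex hull of incidence vectors of all tours of $K_n$. *)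

theory Defs
  imports "HOL-Analysis.Analysis" "HOL-Library.Function_Algebras" "HOL-Library.Multiset"
begin

text \<open>Pointwise vector space structure on functions, so that the library's \<open>convex hull\<close>
  applies to functions from edges to reals.\<close>

instantiation "fun" :: (type, real_vector) real_vector
begin

definition scaleR_fun :: "real \<Rightarrow> ('a \<Rightarrow> 'b) \<Rightarrow> 'a \<Rightarrow> 'b"
  where "scaleR_fun r f = (\<lambda>a. r *\<^sub>R f a)"

instance
  by standard (auto simp: scaleR_fun_def fun_eq_iff scaleR_add_right scaleR_add_left)

end

lemma scaleR_fun_apply [simp]: "(r *\<^sub>R f) a = r *\<^sub>R f a"
  by (simp add: scaleR_fun_def)

text \<open>A simple graph is given by a vertex set and a set of edges, an edge being a set of two
  vertices.\<close>

definition complete_edges :: "'a set \<Rightarrow> 'a set set"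
  where "complete_edges V = {e. e \<subseteq> V \<and> card e = 2}"

definition V\<^sub>K :: "nat \<Rightarrow> nat set"
  where "V\<^sub>K n = {1..n}"

definition E\<^sub>K :: "nat \<Rightarrow> nat set set"
  where "E\<^sub>K n = complete_edges (V\<^sub>K n)"

text \<open>\<open>cut_edges E U\<close> is \<open>\<delta>\<^sub>G(U)\<close> for a graph \<open>G\<close> with edge set \<open>E\<close>.\<close>

definition cut_edges :: "'a set set \<Rightarrow> 'a set \<Rightarrow> 'a set set"
  where "cut_edges E U = {e \<in> E. card (e \<inter> U) = 1}"

definition connected_graph :: "'a set \<Rightarrow> 'a set set \<Rightarrow> bool"
  where "connected_graph V E \<longleftrightarrow> (\<forall>u\<in>V. \<forall>v\<in>V. (u, v) \<in> {(a, b). {a, b} \<in> E}\<^sup>*)"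

text \<open>The edges of the closed walk visiting the listed vertices in order.\<close>

definition closed_walk_edges :: "'a list \<Rightarrow> 'a set set"
  where "closed_walk_edges vs = {{vs ! i, vs ! (Suc i mod length vs)} | i. i < length vs}"

definition cycle_in :: "'a set set \<Rightarrow> 'a list \<Rightarrow> bool"
  where "cycle_in E vs \<longleftrightarrow> 3 \<le> length vs \<and> distinct vs \<and> closed_walk_edges vs \<subseteq> E"

definition hamiltonian_cycle :: "'a set \<Rightarrow> 'a set set \<Rightarrow> 'a set set \<Rightarrow> bool"
  where "hamiltonian_cycle V E H \<longleftrightarrow>
    (\<exists>vs. cycle_in E vs \<and> set vs = V \<and> H = closed_walk_edges vs)"

definition spanning_tree_on :: "'a set \<Rightarrow> 'a set set \<Rightarrow> bool"
  where "spanning_tree_on V T \<longleftrightarrow>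
    T \<subseteq> complete_edges V \<and> connected_graph V T \<and> (\<nexists>vs. cycle_in T vs)"

definition one_tree :: "nat \<Rightarrow> nat set set \<Rightarrow> bool"
  where "one_tree n F \<longleftrightarrow>
    F \<subseteq> E\<^sub>K n \<and> card (F \<inter> cut_edges (E\<^sub>K n) {1}) = 2 \<and>
    spanning_tree_on (V\<^sub>K n - {1}) (F - cut_edges (E\<^sub>K n) {1})"

text \<open>Vectors indexed by \<open>E\<^sub>K n\<close> are represented as functions on all sets of naturals that
  vanish outside \<open>E\<^sub>K n\<close>.\<close>

definition S_polytope :: "nat \<Rightarrow> (nat set \<Rightarrow> real) set"
  where "S_polytope n = {x.
    (\<forall>e. e \<notin> E\<^sub>K n \<longrightarrow> x e = 0) \<and>
    (\<forall>v\<in>V\<^sub>K n. sum x (cut_edges (E\<^sub>K n) {v}) = 2) \<and>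
    (\<forall>S. S \<noteq> {} \<and> S \<subset> V\<^sub>K n \<longrightarrow> sum x (cut_edges (E\<^sub>K n) S) \<ge> 2) \<and>
    (\<forall>e\<in>E\<^sub>K n. 0 \<le> x e \<and> x e \<le> 1)}"

definition support_edges :: "nat \<Rightarrow> (nat set \<Rightarrow> real) \<Rightarrow> nat set set"
  where "support_edges n x = {e \<in> E\<^sub>K n. x e > 0}"

definition half_integer :: "nat \<Rightarrow> (nat set \<Rightarrow> real) \<Rightarrow> bool"
  where "half_integer n x \<longleftrightarrow> (\<forall>e\<in>E\<^sub>K n. x e \<in> {0, 1/2, 1})"

definition tour :: "nat \<Rightarrow> nat set multiset \<Rightarrow> bool"
  where "tour n J \<longleftrightarrow>
    set_mset J \<subseteq> E\<^sub>K n \<and> connected_graph (V\<^sub>K n) (set_mset J) \<and>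
    (\<forall>v\<in>V\<^sub>K n. even (size {#e \<in># J. v \<in> e#}))"

definition multi_incidence :: "'a set multiset \<Rightarrow> 'a set \<Rightarrow> real"
  where "multi_incidence J = (\<lambda>e. real (count J e))"

definition T_polyhedron :: "nat \<Rightarrow> (nat set \<Rightarrow> real) set"
  where "T_polyhedron n = convex hull {multi_incidence J | J. tour n J}"

end

theory Submission
  imports Defs
begin

text \<open>
  Let \<open>y = (2/3) x - (1/6) \<chi>\<^sup>H\<close>. A cut of the support graph has an even number \<open>h\<close> of edges in \<open>H\<close>
  and value \<open>y(\<delta>(S)) = (2/3) x(\<delta>(S)) - h/6\<close>, which is at least 1 unless the cut consists of exactly
  four half-edges of \<open>H\<close>. By hypothesis the latter cuts meet each 1-tree \<open>F\<close> evenly, so \<open>y\<close> covers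
  every cut that \<open>F\<close> meets oddly. By the Edmonds--Johnson theorem \<open>y\<close> dominates a convex combination
  of edge sets \<open>J\<close> with the same odd-degree vertices as \<open>F\<close>; each \<open>F + J\<close> is a tour, and averaging over
  the 1-trees gives \<open>x + y \<in> T\<^sup>n\<close>. Finally \<open>(10/7) x = (6/7) (x + y) + (1/7) \<chi>\<^sup>H\<close>.

  The Edmonds--Johnson theorem is obtained from the inequality "minimum weight of a \<open>T\<close>-join is at most
  \<open>w \<cdot> y\<close>" for all weights \<open>w \<ge> 0\<close>. For integral weights that are even on all cycles this goes by
  induction on the total weight: some \<open>T\<close>-odd cut of positive edges can be lowered by 1 so that the
  minimum drops by at most 1.
\<close>

subsection \<open>Odd-degree vertices and joins\<close>

text \<open>A \<open>T\<close>-join is encoded throughout as an edge set \<open>X\<close> with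
  \<open>odd_vertices X = T\<close>; the case \<open>T = {}\<close> gives the even subgraphs, which
  play the role of cycles.\<close>

definition odd_vertices :: "'a set set \<Rightarrow> 'a set"
  where "odd_vertices X = {v. odd (card {e \<in> X. v \<in> e})}"

lemma odd_card_sym_diff:
  assumes "finite A" "finite B"
  shows "odd (card (sym_diff A B)) \<longleftrightarrow> odd (card A) \<noteq> odd (card B)"
proof -
  have "card (sym_diff A B) = card (A - B) + card (B - A)"
    using assms by (intro card_Un_disjoint) auto
  moreover have "card A = card (A - B) + card (A \<inter> B)"
    using assms by (metis card_Diff_subset_Int card_mono finite_Int inf_le1 le_add_diff_inverse2)
  moreover have "card B = card (B - A) + card (A \<inter> B)"
    using assms by (metis card_Diff_subset_Int card_mono finite_Int inf_le1 inf_commute le_add_diff_inverse2)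
  ultimately show ?thesis by auto
qed

text \<open>Degrees modulo 2 are additive over GF(2). This turns every exchange between joins below
  into a computation with symmetric differences.\<close>

lemma odd_vertices_sym_diff:
  assumes "finite X" "finite Y"
  shows "odd_vertices (sym_diff X Y) = sym_diff (odd_vertices X) (odd_vertices Y)"
proof -
  have "odd (card {e \<in> sym_diff X Y. v \<in> e}) \<longleftrightarrow>
      odd (card {e \<in> X. v \<in> e}) \<noteq> odd (card {e \<in> Y. v \<in> e})" for v
  proof -
    have "{e \<in> sym_diff X Y. v \<in> e} = sym_diff {e \<in> X. v \<in> e} {e \<in> Y. v \<in> e}" by auto
    then show ?thesis using odd_card_sym_diff[of "{e \<in> X. v \<in> e}" "{e \<in> Y. v \<in> e}"] assms by simp
  qed
  then show ?thesis unfolding odd_vertices_def by auto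
qed

lemma odd_vertices_empty [simp]: "odd_vertices {} = {}"
  by (simp add: odd_vertices_def)

lemma odd_vertices_single [simp]: "odd_vertices {e} = e"
proof -
  have "{d \<in> {e}. v \<in> d} = (if v \<in> e then {e} else {})" for v by auto
  then show ?thesis by (auto simp: odd_vertices_def)
qed

lemma odd_vertices_insert:
  assumes "finite X" "e \<notin> X"
  shows "odd_vertices (insert e X) = sym_diff (odd_vertices X) e"
proof -
  have "insert e X = sym_diff X {e}" using assms by auto
  then show ?thesis using odd_vertices_sym_diff[of X "{e}"] assms by simp
qed

lemma odd_vertices_Diff:
  assumes "finite X" "Y \<subseteq> X"
  shows "odd_vertices (X - Y) = sym_diff (odd_vertices X) (odd_vertices Y)"
proof -
  have "X - Y = sym_diff X Y" using assms by auto
  then show ?thesis using odd_vertices_sym_diff[of X Y] assms finite_subset by metis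
qed

lemma odd_vertices_subset:
  assumes "X \<subseteq> complete_edges V"
  shows "odd_vertices X \<subseteq> V"
proof
  fix v assume "v \<in> odd_vertices X"
  then have "{e \<in> X. v \<in> e} \<noteq> {}" by (auto simp: odd_vertices_def simp del: Collect_empty_eq)
  then show "v \<in> V" using assms by (auto simp: complete_edges_def)
qed

lemma finite_complete_edges: "finite V \<Longrightarrow> finite (complete_edges V)"
  by (simp add: complete_edges_def)

text \<open>Handshake argument: the degree sum over \<open>S\<close> counts edges inside
  \<open>S\<close> twice and cut edges once. Edge by edge, both parities flip exactly when the new
  edge has a single end in \<open>S\<close>.\<close>

lemma odd_card_inter_odd_vertices:
  assumes "finite X" "\<And>e. e \<in> X \<Longrightarrow> card e = 2"
  shows "odd (card (S \<inter> odd_vertices X)) \<longleftrightarrow> odd (card (cut_edges X S))"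
  using assms
proof (induction X rule: finite_induct)
  case empty
  then show ?case by (simp add: cut_edges_def)
next
  case (insert e X)
  have fe: "finite e" using insert.prems[of e] by (auto intro: card_ge_0_finite)
  have fX: "finite (odd_vertices X)"
  proof (rule finite_subset[OF odd_vertices_subset])
    show "X \<subseteq> complete_edges (\<Union>X)" using insert.prems by (auto simp: complete_edges_def)
    show "finite (\<Union>X)"
    proof (rule finite_Union[OF insert.hyps(1)])
      fix d assume "d \<in> X"
      then have "card d = 2" using insert.prems by simp
      then show "finite d" by (simp add: card_ge_0_finite)
    qed
  qed
  have "S \<inter> odd_vertices (insert e X) = sym_diff (S \<inter> odd_vertices X) (S \<inter> e)"
    using odd_vertices_insert[OF insert.hyps] by auto
  then have 1: "odd (card (S \<inter> odd_vertices (insert e X))) \<longleftrightarrow>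
      odd (card (S \<inter> odd_vertices X)) \<noteq> odd (card (S \<inter> e))"
    using odd_card_sym_diff[of "S \<inter> odd_vertices X" "S \<inter> e"] fe fX by simp
  have "card (S \<inter> e) \<le> 2" using card_mono[OF fe, of "S \<inter> e"] insert.prems[of e] by auto
  then have 2: "odd (card (S \<inter> e)) \<longleftrightarrow> card (e \<inter> S) = 1"
    by (auto simp: Int_commute le_Suc_eq numeral_2_eq_2)
  have 3: "cut_edges (insert e X) S = (if card (e \<inter> S) = 1 then insert e (cut_edges X S) else cut_edges X S)"
    by (auto simp: cut_edges_def)
  have "e \<notin> cut_edges X S" "finite (cut_edges X S)"
    using insert.hyps by (auto simp: cut_edges_def)
  then have 4: "odd (card (cut_edges (insert e X) S)) \<longleftrightarrow>
      odd (card (cut_edges X S)) \<noteq> (card (e \<inter> S) = 1)"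
    unfolding 3 by simp
  have "odd (card (S \<inter> odd_vertices X)) \<longleftrightarrow> odd (card (cut_edges X S))"
    by (rule insert.IH) (simp add: insert.prems)
  then show ?case unfolding 1 2 4 by blast
qed

lemma even_card_odd_vertices:
  assumes "finite V" "X \<subseteq> complete_edges V"
  shows "even (card (odd_vertices X))"
proof -
  have "cut_edges X V = {}"
    using assms by (auto simp: cut_edges_def complete_edges_def Int_absorb2)
  moreover have "V \<inter> odd_vertices X = odd_vertices X" using odd_vertices_subset[OF assms(2)] by auto
  moreover have "finite X" using assms finite_complete_edges finite_subset by blast
  ultimately show ?thesis
    using odd_card_inter_odd_vertices[of X V] assms by (auto simp: complete_edges_def)
qed

lemma reachable_join:
  assumes "finite D" "\<And>e. e \<in> D \<Longrightarrow> card e = 2"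
    and "(a, b) \<in> {(a, b). {a, b} \<in> D}\<^sup>*"
  shows "\<exists>X\<subseteq>D. odd_vertices X = sym_diff {a} {b}"
  using assms(3)
proof (induction rule: rtrancl_induct)
  case base
  then show ?case by (intro exI[of _ "{}"]) auto
next
  case (step b c)
  then obtain X where X: "X \<subseteq> D" "odd_vertices X = sym_diff {a} {b}" by blast
  have bc: "{b, c} \<in> D" using step by simp
  then have "b \<noteq> c" using assms(2)[of "{b, c}"] by auto
  have "odd_vertices (sym_diff X {{b, c}}) = sym_diff (sym_diff {a} {b}) {b, c}"
    using odd_vertices_sym_diff[of X "{{b, c}}"] X finite_subset[OF X(1) assms(1)] by simp
  also have "\<dots> = sym_diff {a} {c}" using \<open>b \<noteq> c\<close> by auto
  finally show ?case using X bc by (intro exI[of _ "sym_diff X {{b, c}}"]) auto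
qed

text \<open>Pair up the vertices of \<open>A\<close> and add, modulo 2, a path of \<open>D\<close>
  for each pair; the induction removes one pair at a time.\<close>

lemma connected_even_join:
  assumes "finite D" "\<And>e. e \<in> D \<Longrightarrow> card e = 2"
    and "finite A" "even (card A)"
    and "\<And>a b. a \<in> A \<Longrightarrow> b \<in> A \<Longrightarrow> (a, b) \<in> {(a, b). {a, b} \<in> D}\<^sup>*"
  shows "\<exists>X\<subseteq>D. odd_vertices X = A"
  using assms(3-)
proof (induction "card A" arbitrary: A rule: less_induct)
  case less
  show ?case
  proof (cases "A = {}")
    case True
    then show ?thesis by (intro exI[of _ "{}"]) auto
  next
    case False
    then obtain a where a: "a \<in> A" by auto
    have "A \<noteq> {a}" using less.prems by auto
    then obtain b where b: "b \<in> A" "b \<noteq> a" using a by auto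
    let ?B = "A - {a, b}"
    have c: "card A = card ?B + 2"
      using card_Diff_subset[of "{a, b}" A] card_mono[of A "{a, b}"] a b less.prems by auto
    have "even (card ?B)" using c less.prems(2) by simp
    then obtain X where X: "X \<subseteq> D" "odd_vertices X = ?B"
      using less.hyps[of ?B] less.prems c by auto
    obtain Y where Y: "Y \<subseteq> D" "odd_vertices Y = sym_diff {a} {b}"
      using reachable_join[OF assms(1,2) less.prems(3)[OF a b(1)]] by auto
    have "odd_vertices (sym_diff X Y) = sym_diff ?B (sym_diff {a} {b})"
      using odd_vertices_sym_diff[of X Y] X Y assms(1) finite_subset by metis
    also have "\<dots> = A" using a b by auto
    finally show ?thesis using X Y by (intro exI[of _ "sym_diff X Y"]) auto
  qed
qed

section \<open>Paths and cycles crossing a cut\<close>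

lemma card_2_cut:
  assumes "card e = 2" "card (e \<inter> S) = 1"
  obtains a b where "e = {a, b}" "a \<noteq> b" "a \<in> S" "b \<notin> S"
proof -
  obtain a b where ab: "e = {a, b}" "a \<noteq> b" using assms(1) by (auto simp: card_2_iff)
  consider "a \<in> S" "b \<in> S" | "a \<notin> S" "b \<notin> S" | "a \<in> S" "b \<notin> S" | "a \<notin> S" "b \<in> S" by blast
  then show thesis
  proof cases
    case 1
    then have "e \<inter> S = e" using ab by auto
    then show ?thesis using assms by simp
  next
    case 2
    then have "e \<inter> S = {}" using ab by auto
    then show ?thesis using assms by simp
  next
    case 3
    then show ?thesis using ab that by blast
  next
    case 4
    then show ?thesis using ab that[of b a] by (auto simp: insert_commute)
  qed
qed

lemma card_cut_1I: "a \<in> S \<Longrightarrow> b \<notin> S \<Longrightarrow> card ({a, b} \<inter> S) = 1"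
  by (simp add: Int_insert_left)

text \<open>\<open>C\<close> is the component of \<open>a\<close> after deleting the vertices of
  \<open>K\<close>, so an edge of \<open>D\<close> leaving \<open>C\<close> can only end in
  \<open>K\<close>.\<close>

lemma component_outside:
  assumes "finite D" "\<And>e. e \<in> D \<Longrightarrow> card e = 2" "a \<notin> K"
  obtains C where "a \<in> C" "C \<inter> K = {}" "cut_edges D C \<subseteq> cut_edges D K"
    "\<And>b. b \<in> C \<Longrightarrow> \<exists>X\<subseteq>{e \<in> D. e \<inter> K = {}}. odd_vertices X = sym_diff {a} {b}"
proof -
  define D' where "D' = {e \<in> D. e \<inter> K = {}}"
  define C where "C = {z. (a, z) \<in> {(a, b). {a, b} \<in> D'}\<^sup>*}"
  have D': "finite D'" "\<And>e. e \<in> D' \<Longrightarrow> card e = 2" using assms by (auto simp: D'_def)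
  have 1: "a \<in> C" by (simp add: C_def)
  have 2: "C \<inter> K = {}"
  proof -
    have "z \<notin> K" if "(a, z) \<in> {(a, b). {a, b} \<in> D'}\<^sup>*" for z
      using that by (induction rule: rtrancl_induct) (use assms in \<open>auto simp: D'_def\<close>)
    then show ?thesis by (auto simp: C_def)
  qed
  have 3: "cut_edges D C \<subseteq> cut_edges D K"
  proof
    fix e assume e: "e \<in> cut_edges D C"
    then have eD: "e \<in> D" "card (e \<inter> C) = 1" by (auto simp: cut_edges_def)
    then obtain p q where pq: "e = {p, q}" "p \<noteq> q" "p \<in> C" "q \<notin> C"
      using card_2_cut[OF assms(2)] by metis
    have "q \<in> K"
    proof (rule ccontr)
      assume "q \<notin> K"
      then have "e \<in> D'" using eD pq 2 by (auto simp: D'_def)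
      then have "q \<in> C" using pq(3) unfolding C_def pq(1)
        by (auto intro: rtrancl_into_rtrancl)
      then show False using pq by simp
    qed
    moreover have "p \<notin> K" using pq 2 by auto
    ultimately show "e \<in> cut_edges D K" using eD card_cut_1I[of q K p] pq
      by (auto simp: cut_edges_def insert_commute)
  qed
  have 4: "\<exists>X\<subseteq>D'. odd_vertices X = sym_diff {a} {b}" if "b \<in> C" for b
    using reachable_join[OF D', of a b] that by (simp add: C_def)
  show thesis using that[OF 1 2 3] 4 by (simp add: D'_def)
qed

text \<open>A path of \<open>D\<close> from \<open>u\<close> that stops as soon as it enters \<open>K\<close>.\<close>

lemma path_piece:
  assumes "finite D" "\<And>e. e \<in> D \<Longrightarrow> card e = 2" "odd_vertices D - K = {u}"
  shows "\<exists>P\<subseteq>D. odd_vertices P - K = {u} \<and> card (cut_edges P K) = 1"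
proof -
  have "u \<notin> K" using assms(3) by auto
  then obtain C where C: "u \<in> C" "C \<inter> K = {}" "cut_edges D C \<subseteq> cut_edges D K"
    "\<And>b. b \<in> C \<Longrightarrow> \<exists>X\<subseteq>{e \<in> D. e \<inter> K = {}}. odd_vertices X = sym_diff {u} {b}"
    using component_outside[OF assms(1,2)] by blast
  \<comment> \<open>All other odd vertices lie in \<open>K\<close>, so \<open>u\<close> is the only
    one in \<open>C\<close>. By the handshake argument some edge of \<open>D\<close> leaves
    \<open>C\<close>, and this edge becomes the entry into \<open>K\<close>.\<close>
  have "C \<inter> odd_vertices D = {u}" using C assms(3) by blast
  then have "odd (card (cut_edges D C))"
    using odd_card_inter_odd_vertices[OF assms(1,2), of C] by simp
  then have "cut_edges D C \<noteq> {}" by auto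
  then obtain e where e: "e \<in> cut_edges D C" by blast
  then have eD: "e \<in> D" "card (e \<inter> C) = 1" by (auto simp: cut_edges_def)
  then obtain p q where pq: "e = {p, q}" "p \<noteq> q" "p \<in> C" "q \<notin> C"
    using card_2_cut[OF assms(2)] by metis
  have eK: "card (e \<inter> K) = 1" using e C(3) by (auto simp: cut_edges_def)
  have "p \<notin> K" using pq C by auto
  then have "q \<in> K" using eK pq by (auto simp: Int_insert_left split: if_splits)
  obtain X where X: "X \<subseteq> {e \<in> D. e \<inter> K = {}}" "odd_vertices X = sym_diff {u} {p}"
    using C(4)[OF pq(3)] by blast
  have "e \<notin> X" using X pq \<open>q \<in> K\<close> by auto
  have "finite X" using X assms(1) finite_subset by (metis (no_types, lifting) mem_Collect_eq subset_iff subsetI)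
  then have "odd_vertices (insert e X) = sym_diff (sym_diff {u} {p}) {p, q}"
    using odd_vertices_insert[OF _ \<open>e \<notin> X\<close>] X pq by simp
  then have "odd_vertices (insert e X) - K = {u}"
    using \<open>p \<notin> K\<close> \<open>q \<in> K\<close> \<open>u \<notin> K\<close> by auto
  moreover have "cut_edges X K = {}"
  proof -
    have "card (d \<inter> K) = 0" if "d \<in> X" for d
    proof -
      have "d \<inter> K = {}" using X(1) that by blast
      then show ?thesis by simp
    qed
    then show ?thesis by (auto simp: cut_edges_def)
  qed
  then have "cut_edges (insert e X) K = {e}" using eK by (auto simp: cut_edges_def)
  ultimately show ?thesis using X eD by (intro exI[of _ "insert e X"]) auto
qed

text \<open>With \<open>K\<close> contracted, \<open>D\<close> is even. Removing a crossing edge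
  makes its outer end the only odd vertex outside \<open>K\<close>; a path from there back into
  \<open>K\<close> closes a cycle through \<open>K\<close> with exactly two crossing edges.\<close>

lemma cycle_piece:
  assumes "finite D" "\<And>e. e \<in> D \<Longrightarrow> card e = 2" "odd_vertices D \<subseteq> K" "cut_edges D K \<noteq> {}"
  shows "\<exists>C\<subseteq>D. odd_vertices C \<subseteq> K \<and> card (cut_edges C K) = 2"
proof -
  obtain e where e: "e \<in> D" "card (e \<inter> K) = 1" using assms(4) by (auto simp: cut_edges_def)
  then obtain p q where pq: "e = {p, q}" "p \<noteq> q" "p \<in> K" "q \<notin> K"
    using card_2_cut[OF assms(2)] by metis
  have "odd_vertices (D - {e}) = sym_diff (odd_vertices D) e"
    using odd_vertices_Diff[OF assms(1), of "{e}"] e by simp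
  then have "odd_vertices (D - {e}) - K = {q}" using assms(3) pq by auto
  then obtain P where P: "P \<subseteq> D - {e}" "odd_vertices P - K = {q}" "card (cut_edges P K) = 1"
    using path_piece[of "D - {e}" K q] assms(1,2) by auto
  have fP: "finite P" using P(1) assms(1) finite_subset by auto
  have "odd_vertices (insert e P) = sym_diff (odd_vertices P) e"
    using odd_vertices_insert[OF fP, of e] P(1) by auto
  then have "odd_vertices (insert e P) \<subseteq> K" using P(2) pq by auto
  moreover have "cut_edges (insert e P) K = insert e (cut_edges P K)"
    using e by (auto simp: cut_edges_def)
  moreover have "e \<notin> cut_edges P K" "finite (cut_edges P K)" using P(1) fP by (auto simp: cut_edges_def)
  ultimately show ?thesis using P e by (intro exI[of _ "insert e P"]) auto
qed

text \<open>Cycles through \<open>K\<close> are peeled off one by one: each accounts for two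
  crossing edges and costs at least 2. What is left over has no crossing edge and nonnegative
  cost.\<close>

lemma card_cut_le_cost:
  fixes c :: "'a set \<Rightarrow> int"
  assumes "finite E" "\<And>e. e \<in> E \<Longrightarrow> card e = 2"
    and nonneg: "\<And>C. C \<subseteq> E \<Longrightarrow> odd_vertices C \<subseteq> K \<Longrightarrow> 0 \<le> sum c C"
    and two: "\<And>C. C \<subseteq> E \<Longrightarrow> odd_vertices C \<subseteq> K \<Longrightarrow> cut_edges C K \<noteq> {} \<Longrightarrow> 2 \<le> sum c C"
    and "D \<subseteq> E" "odd_vertices D \<subseteq> K"
  shows "int (card (cut_edges D K)) \<le> sum c D"
  using assms(5,6)
proof (induction "card (cut_edges D K)" arbitrary: D rule: less_induct)
  case less
  have fD: "finite D" using less.prems assms(1) finite_subset by auto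
  then have fc: "finite (cut_edges D K)" by (simp add: cut_edges_def)
  show ?case
  proof (cases "cut_edges D K = {}")
    case True
    then show ?thesis using nonneg[OF less.prems] by simp
  next
    case False
    then obtain C where C: "C \<subseteq> D" "odd_vertices C \<subseteq> K" "card (cut_edges C K) = 2"
      using cycle_piece[OF fD _ less.prems(2)] assms(2) less.prems(1) by (meson subsetD)
    have "cut_edges (D - C) K = cut_edges D K - cut_edges C K" using C by (auto simp: cut_edges_def)
    moreover have sub: "cut_edges C K \<subseteq> cut_edges D K" using C by (auto simp: cut_edges_def)
    ultimately have card: "card (cut_edges D K) = card (cut_edges (D - C) K) + 2"
      using C(3) card_Diff_subset[of "cut_edges C K" "cut_edges D K"] card_mono[OF fc sub] fc
        finite_subset[OF sub fc] by simp
    have "odd_vertices (D - C) \<subseteq> K" using odd_vertices_Diff[OF fD C(1)] C less.prems by auto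
    then have "int (card (cut_edges (D - C) K)) \<le> sum c (D - C)"
      using less.hyps[of "D - C"] less.prems card by auto
    moreover have "cut_edges C K \<noteq> {}" using C(3) by auto
    then have "2 \<le> sum c C" using two[of C] C less.prems by auto
    moreover have "sum c D = sum c (D - C) + sum c C" using C(1) fD by (simp add: sum.subset_diff)
    ultimately show ?thesis using card by simp
  qed
qed

subsection \<open>Minimum weight joins\<close>

lemma sum_sym_diff_null:
  fixes w :: "'a \<Rightarrow> nat"
  assumes "finite X" "finite Y" "\<And>e. e \<in> Y \<Longrightarrow> w e = 0"
  shows "sum w (sym_diff X Y) = sum w X"
proof -
  have "sum w (sym_diff X Y) = sum w (X - Y)"
    using assms by (intro sum.mono_neutral_right) auto
  also have "\<dots> = sum w X" using assms by (intro sum.mono_neutral_left) auto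
  finally show ?thesis .
qed

text \<open>The signed sum is the cost of switching \<open>F\<close> along \<open>D\<close>: edges
  already in \<open>F\<close> are given up, the others are paid for.\<close>

lemma sum_sym_diff_signed:
  fixes w :: "'a \<Rightarrow> nat"
  assumes "finite D" "finite F"
  shows "int (sum w (sym_diff D F)) =
    int (sum w F) + (\<Sum>e\<in>D. if e \<in> F then - int (w e) else int (w e))"
proof -
  have "sum w (sym_diff D F) = sum w (D - F) + sum w (F - D)"
    using assms by (intro sum.union_disjoint) auto
  moreover have "sum w F = sum w (F - D) + sum w (D \<inter> F)"
    using assms by (metis Int_commute sum.Int_Diff add.commute)
  moreover have "(\<Sum>e\<in>D. if e \<in> F then - int (w e) else int (w e)) =
      - int (sum w (D \<inter> F)) + int (sum w (D - F))"
    using assms sum.If_cases[of D "\<lambda>e. e \<in> F" "\<lambda>e. - int (w e)" "\<lambda>e. int (w e)"]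
    by (simp add: sum_negf Diff_eq)
  ultimately show ?thesis by simp
qed

lemma even_sum_signed:
  fixes w :: "'a \<Rightarrow> nat"
  shows "even (\<Sum>e\<in>D. if e \<in> F then - int (w e) else int (w e)) \<longleftrightarrow> even (sum w D)"
proof -
  have "even (int (sum w D) - (\<Sum>e\<in>D. if e \<in> F then - int (w e) else int (w e)))"
    unfolding of_nat_sum sum_subtractf[symmetric] by (intro dvd_sum) auto
  then show ?thesis by (auto simp only: even_diff even_add even_of_nat)
qed

text \<open>The idea, following Sebo: over all \<open>u, v\<close>, let \<open>F'\<close> be a join of the symmetric difference of \<open>T\<close> and
  \<open>{u, v}\<close> of least weight, and let \<open>K\<close> be the weight-zero component of \<open>v\<close>. No optimal \<open>F'\<close>
  has an edge leaving \<open>K\<close>, so every cycle through \<open>K\<close> (with \<open>K\<close> contracted) has positive, hence by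
  parity at least 2, cost relative to \<open>F'\<close>.\<close>

lemma exists_odd_cut_met_once:
  fixes w :: "'a set \<Rightarrow> nat"
  assumes "finite V" and EV: "E \<subseteq> complete_edges V"
    and cycles: "\<And>X. X \<subseteq> E \<Longrightarrow> odd_vertices X = {} \<Longrightarrow> even (sum w X)"
    and F: "F \<subseteq> E" "odd_vertices F = T" "sum w F > 0"
    and F_min: "\<And>J. J \<subseteq> E \<Longrightarrow> odd_vertices J = T \<Longrightarrow> sum w F \<le> sum w J"
  shows "\<exists>K\<subseteq>V. odd (card (K \<inter> T)) \<and> (\<forall>e\<in>cut_edges E K. 0 < w e) \<and>
    (\<forall>J\<subseteq>E. odd_vertices J = T \<longrightarrow> sum w F + card (cut_edges J K) \<le> sum w J + 1)"
proof -
  have fE: "finite E" using EV assms(1) finite_complete_edges finite_subset by blast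
  have fin: "finite X" if "X \<subseteq> E" for X using that fE finite_subset by blast
  have two: "card e = 2" if "e \<in> E" for e using that EV by (auto simp: complete_edges_def)
  have TV: "T \<subseteq> V" using odd_vertices_subset[of F V] F EV by blast
  have fT: "finite T" using TV assms(1) finite_subset by blast
  have ov: "odd_vertices (sym_diff X Y) = sym_diff (odd_vertices X) (odd_vertices Y)"
    if "X \<subseteq> E" "Y \<subseteq> E" for X Y
    using odd_vertices_sym_diff fin that by blast
  \<comment> \<open>The pair \<open>u\<close>, \<open>v\<close> is free, which lets an end of a join
    be moved in the exchanges below; \<open>u = v\<close> covers the \<open>T\<close>-joins
    themselves.\<close>
  define M where "M X \<longleftrightarrow> X \<subseteq> E \<and> (\<exists>u\<in>V. \<exists>v\<in>V. odd_vertices X = sym_diff T (sym_diff {u} {v}))" for X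
  obtain e0 where e0: "e0 \<in> F" "w e0 > 0" using F(3) by (metis gr0I less_irrefl sum.neutral)
  obtain a0 b0 where ab0: "e0 = {a0, b0}" "a0 \<noteq> b0" using e0 F two by (meson card_2_iff subsetD)
  have ab0V: "a0 \<in> V" "b0 \<in> V" using e0 ab0 F EV by (auto simp: complete_edges_def)
  \<comment> \<open>Dropping a positive edge of \<open>F\<close> moves the target to its two ends.
    Hence the minimiser \<open>F'\<close> over \<open>M\<close> is strictly lighter than every
    \<open>T\<close>-join.\<close>
  have M0: "M (F - {e0})"
  proof -
    have "odd_vertices (F - {e0}) = sym_diff T e0"
      using odd_vertices_Diff[of F "{e0}"] e0 F fin by simp
    also have "\<dots> = sym_diff T (sym_diff {a0} {b0})" using ab0 by auto
    finally show ?thesis using F ab0V unfolding M_def by blast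
  qed
  obtain F' where F': "M F'" and F'_min: "\<And>X. M X \<Longrightarrow> sum w F' \<le> sum w X"
    using ex_has_least_nat[of M "F - {e0}" "sum w", OF M0] by blast
  have "sum w F = w e0 + sum w (F - {e0})" using e0 F fin by (simp add: sum.remove)
  then have less: "sum w F' < sum w F" using F'_min[OF M0] e0 by simp
  have F'E: "F' \<subseteq> E" using F' M_def by blast
  obtain u v where uv: "u \<in> V" "v \<in> V" and T': "odd_vertices F' = sym_diff T (sym_diff {u} {v})"
    using F' unfolding M_def by blast
  define Z where "Z = {e \<in> E. w e = 0}"
  define K where "K = {z. (v, z) \<in> {(a, b). {a, b} \<in> Z}\<^sup>*}"
  have Z: "finite Z" "\<And>e. e \<in> Z \<Longrightarrow> card e = 2" "Z \<subseteq> E" using fE two by (auto simp: Z_def)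
  have vK: "v \<in> K" by (simp add: K_def)
  have KV: "K \<subseteq> V"
  proof -
    have "z \<in> V" if "(v, z) \<in> {(a, b). {a, b} \<in> Z}\<^sup>*" for z
      using that
    proof (induction rule: rtrancl_induct)
      case base
      then show ?case by (rule uv)
    next
      case (step y z)
      then have "{y, z} \<in> complete_edges V" using Z(3) EV by auto
      then show ?case by (auto simp: complete_edges_def)
    qed
    then show ?thesis by (auto simp: K_def)
  qed
  have fK: "finite K" using KV assms(1) finite_subset by blast
  have cut_pos: "0 < w e" if "e \<in> cut_edges E K" for e
  proof (rule ccontr)
    assume "\<not> 0 < w e"
    then have eZ: "e \<in> Z" using that by (auto simp: Z_def cut_edges_def)
    have "card (e \<inter> K) = 1" using that by (auto simp: cut_edges_def)
    then obtain p q where pq: "e = {p, q}" "p \<in> K" "q \<notin> K"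
      using card_2_cut[OF Z(2)[OF eZ]] by metis
    have "q \<in> K" using pq(2) eZ unfolding K_def pq(1) by (auto intro: rtrancl_into_rtrancl)
    then show False using pq by simp
  qed
  have reach: "(a, b) \<in> {(a, b). {a, b} \<in> Z}\<^sup>*" if "a \<in> K" "b \<in> K" for a b
  proof -
    have "sym {(a, b). {a, b} \<in> Z}" by (auto simp: sym_def insert_commute)
    moreover have "(v, a) \<in> {(a, b). {a, b} \<in> Z}\<^sup>*" "(v, b) \<in> {(a, b). {a, b} \<in> Z}\<^sup>*"
      using that by (simp_all add: K_def)
    ultimately show ?thesis by (meson rtrancl_trans sym_rtrancl symD)
  qed
  have zero_join: "\<exists>Y\<subseteq>Z. odd_vertices Y = A" if "A \<subseteq> K" "even (card A)" for A
    by (rule connected_even_join)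
      (use Z(1,2) that finite_subset[OF that(1) fK] in \<open>auto intro: reach[OF subsetD subsetD]\<close>)
  have null: "sum w (sym_diff X Y) = sum w X" if "X \<subseteq> E" "Y \<subseteq> Z" for X Y
    using sum_sym_diff_null[of X Y w] that fin Z finite_subset[OF that(2) Z(1)] by (auto simp: Z_def)
  have pair_join: "\<exists>Y\<subseteq>Z. odd_vertices Y = sym_diff {a} {b}" if "a \<in> K" "b \<in> K" for a b
    using zero_join[of "sym_diff {a} {b}"] that by (cases "a = b") auto
  \<comment> \<open>Otherwise a zero-weight join of \<open>u\<close> and \<open>v\<close> would turn
    \<open>F'\<close> into a \<open>T\<close>-join of the same weight, below the minimum.\<close>
  have uK: "u \<notin> K"
  proof
    assume "u \<in> K"
    then obtain Y where Y: "Y \<subseteq> Z" "odd_vertices Y = sym_diff {u} {v}" using pair_join vK by blast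
    have "odd_vertices (sym_diff F' Y) = sym_diff (sym_diff T (sym_diff {u} {v})) (sym_diff {u} {v})"
      using ov[of F' Y] F'E Y Z T' by auto
    also have "\<dots> = T" by blast
    finally have "sum w F \<le> sum w (sym_diff F' Y)" using F_min[of "sym_diff F' Y"] F'E Y Z by blast
    then show False using null[OF F'E Y(1)] less by simp
  qed
  have uv_ne: "u \<noteq> v" using uK vK by auto
  \<comment> \<open>If \<open>G\<close> crossed \<open>K\<close> along an edge \<open>{p, q}\<close>
    with \<open>p\<close> in \<open>K\<close>, that edge could be dropped and the end
    \<open>v\<close> moved to \<open>p\<close> at no cost. The result joins for the pair
    \<open>u\<close>, \<open>q\<close> and is lighter, as crossing edges have positive
    weight.\<close>
  have no_cut: "cut_edges G K = {}"
    if G: "G \<subseteq> E" "odd_vertices G = odd_vertices F'" "sum w G \<le> sum w F'" for G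
  proof (rule ccontr)
    assume "cut_edges G K \<noteq> {}"
    then obtain e where e: "e \<in> G" "card (e \<inter> K) = 1" by (auto simp: cut_edges_def)
    then obtain p q where pq: "e = {p, q}" "p \<noteq> q" "p \<in> K" "q \<notin> K"
      using card_2_cut two G(1) by (metis subsetD)
    have we: "w e > 0" using cut_pos e G by (auto simp: cut_edges_def)
    obtain Y where Y: "Y \<subseteq> Z" "odd_vertices Y = sym_diff {v} {p}" using pair_join pq vK by blast
    have "odd_vertices (G - {e}) = sym_diff (sym_diff T (sym_diff {u} {v})) {p, q}"
      using odd_vertices_Diff[of G "{e}"] G e fin T' pq by simp
    moreover have "odd_vertices (sym_diff (G - {e}) Y) = sym_diff (odd_vertices (G - {e})) (odd_vertices Y)"
      using ov[of "G - {e}" Y] G(1) Y(1) Z(3) by blast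
    ultimately have "odd_vertices (sym_diff (G - {e}) Y) =
        sym_diff (sym_diff (sym_diff T (sym_diff {u} {v})) {p, q}) (sym_diff {v} {p})"
      using Y(2) by simp
    also have "\<dots> = sym_diff T (sym_diff {u} {q})" using pq(2) by auto
    finally have "odd_vertices (sym_diff (G - {e}) Y) = sym_diff T (sym_diff {u} {q})" .
    moreover have "q \<in> V" using e G EV pq by (auto simp: complete_edges_def)
    moreover have "sym_diff (G - {e}) Y \<subseteq> E" using G(1) Y(1) Z(3) by blast
    ultimately have "M (sym_diff (G - {e}) Y)" using uv(1) unfolding M_def by blast
    then have "sum w F' \<le> sum w (sym_diff (G - {e}) Y)" by (rule F'_min)
    also have "\<dots> = sum w (G - {e})" using null[of "G - {e}" Y] G Y by blast
    also have "\<dots> < sum w G" using e we G fin by (simp add: sum.remove)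
    finally show False using G by simp
  qed
  have F'_cut: "cut_edges F' K = {}" using no_cut[OF F'E] by simp
  \<comment> \<open>\<open>F'\<close> does not cross \<open>K\<close>, so it has evenly many odd
    vertices there; these are \<open>K \<inter> T\<close> with \<open>v\<close> toggled, since
    \<open>u\<close> lies outside.\<close>
  have odd: "odd (card (K \<inter> T))"
  proof -
    have "even (card (K \<inter> odd_vertices F'))"
      using odd_card_inter_odd_vertices[of F' K] F'E fin two F'_cut by (auto simp: subset_iff)
    moreover have "K \<inter> odd_vertices F' = sym_diff (K \<inter> T) {v}" unfolding T' using uK vK by auto
    ultimately show ?thesis using odd_card_sym_diff[of "K \<inter> T" "{v}"] fK by simp
  qed
  define c where "c e = (if e \<in> F' then - int (w e) else int (w e))" for e
  have cost: "int (sum w (sym_diff D F')) = int (sum w F') + sum c D" if "D \<subseteq> E" for D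
    using sum_sym_diff_signed[of D F' w] fin that F'E unfolding c_def by blast
  have even_ov: "even (card (odd_vertices X))" if "X \<subseteq> E" for X
    using even_card_odd_vertices[of V X] assms(1) that EV by blast
  \<comment> \<open>The odd vertices of \<open>C\<close> lie in \<open>K\<close> and are repaired by
    a zero-weight \<open>Y\<close>. Switching \<open>F'\<close> along \<open>C\<close> and
    \<open>Y\<close> keeps its odd vertices and changes the weight by
    \<open>sum c C\<close>.\<close>
  have key: "0 \<le> sum c C \<and> (cut_edges C K \<noteq> {} \<longrightarrow> 2 \<le> sum c C)"
    if C: "C \<subseteq> E" "odd_vertices C \<subseteq> K" for C
  proof -
    obtain Y where Y: "Y \<subseteq> Z" "odd_vertices Y = odd_vertices C"
      using zero_join[OF C(2) even_ov[OF C(1)]] by blast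
    have YE: "Y \<subseteq> E" using Y Z by blast
    let ?G = "sym_diff (sym_diff C F') Y"
    have CF: "sym_diff C F' \<subseteq> E" using C F'E by blast
    have G: "?G \<subseteq> E" using CF YE by blast
    have ovG: "odd_vertices ?G = odd_vertices F'"
      using ov[OF CF YE] ov[OF C(1) F'E] Y(2) by auto
    have "M ?G" using G ovG T' uv unfolding M_def by metis
    then have "sum w F' \<le> sum w ?G" by (rule F'_min)
    moreover have wG: "int (sum w ?G) = int (sum w F') + sum c C"
      using null[OF CF Y(1)] cost[OF C(1)] by simp
    ultimately have 1: "0 \<le> sum c C" by linarith
    \<comment> \<open>A crossing edge of \<open>C\<close> lies neither in \<open>F'\<close> nor
      among the zero-weight edges, so it survives in \<open>?G\<close>. By \<open>no_cut\<close> the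
      cost is then positive, and the parity hypothesis on cycles lifts it to 2.\<close>
    have 2: "2 \<le> sum c C" if cut: "cut_edges C K \<noteq> {}"
    proof -
      obtain e where e: "e \<in> C" "card (e \<inter> K) = 1" using cut by (auto simp: cut_edges_def)
      have "e \<notin> F'" using F'_cut e by (auto simp: cut_edges_def)
      moreover have "e \<notin> Y" using cut_pos[of e] e Y(1) C(1) by (auto simp: cut_edges_def Z_def)
      ultimately have "e \<in> cut_edges ?G K" using e by (auto simp: cut_edges_def)
      then have "\<not> sum w ?G \<le> sum w F'" using no_cut[OF G ovG] by blast
      then have pos: "0 < sum c C" using wG by linarith
      have "odd_vertices (sym_diff C Y) = {}" using ov[OF C(1) YE] Y(2) by blast
      then have "even (sum w (sym_diff C Y))" using cycles[of "sym_diff C Y"] C(1) YE by blast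
      then have "even (sum w C)" using null[OF C(1) Y(1)] by simp
      then have "even (sum c C)" using even_sum_signed[where F = F' and D = C and w = w] unfolding c_def by simp
      then show ?thesis using pos by presburger
    qed
    show ?thesis using 1 2 by blast
  qed
  \<comment> \<open>\<open>D\<close> joins \<open>u\<close> to \<open>v\<close>. Its piece
    \<open>P\<close> from \<open>u\<close> into \<open>K\<close> costs at least
    \<open>sum w F - sum w F'\<close>, since \<open>P\<close> with zero-weight edges switches
    \<open>F'\<close> to a \<open>T\<close>-join. The rest is even outside \<open>K\<close> and pays
    for its crossings; the one crossing of \<open>P\<close> is the \<open>+ 1\<close>.\<close>
  have "sum w F + card (cut_edges J K) \<le> sum w J + 1" if J: "J \<subseteq> E" "odd_vertices J = T" for J
  proof -
    define D where "D = sym_diff J F'"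
    have DE: "D \<subseteq> E" using J F'E by (auto simp: D_def)
    have ovD: "odd_vertices D = sym_diff {u} {v}" unfolding D_def using ov[OF J(1) F'E] J(2) T' by blast
    then have "odd_vertices D - K = {u}" using uK vK by auto
    then obtain P where P: "P \<subseteq> D" "odd_vertices P - K = {u}" "card (cut_edges P K) = 1"
      using path_piece[OF fin[OF DE]] two DE by (meson subsetD)
    have PE: "P \<subseteq> E" using P DE by blast
    let ?A = "sym_diff (odd_vertices P) (sym_diff {u} {v})"
    have AK: "?A \<subseteq> K" using P(2) vK uv_ne by blast
    have fP: "finite (odd_vertices P)"
      using odd_vertices_subset[of P V] PE EV assms(1) finite_subset by (meson subset_trans)
    have "card (sym_diff {u} {v}) = 2" using uv_ne by auto
    then have "even (card ?A)"
      using odd_card_sym_diff[OF fP, of "sym_diff {u} {v}"] even_ov[OF PE] by simp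
    then obtain Y where Y: "Y \<subseteq> Z" "odd_vertices Y = ?A" using zero_join[OF AK] by blast
    have YE: "Y \<subseteq> E" using Y Z by blast
    let ?G = "sym_diff (sym_diff P F') Y"
    have PF: "sym_diff P F' \<subseteq> E" using PE F'E by blast
    have "odd_vertices ?G = sym_diff (sym_diff (odd_vertices P) (sym_diff T (sym_diff {u} {v}))) ?A"
      using ov[OF PF YE] ov[OF PE F'E] Y(2) T' by simp
    also have "\<dots> = T" by blast
    finally have "sum w F \<le> sum w ?G" using F_min[of ?G] PF YE by blast
    then have cP: "int (sum w F) \<le> int (sum w F') + sum c P"
      using null[OF PF Y(1)] cost[OF PE] by linarith
    have "odd_vertices (D - P) = sym_diff (odd_vertices D) (odd_vertices P)"
      using odd_vertices_Diff[OF fin[OF DE] P(1)] .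
    then have "odd_vertices (D - P) \<subseteq> K" using \<open>odd_vertices D - K = {u}\<close> P(2) by blast
    moreover have "D - P \<subseteq> E" using DE by blast
    ultimately have cR: "int (card (cut_edges (D - P) K)) \<le> sum c (D - P)"
      by (intro card_cut_le_cost[where E = E]) (simp_all add: fE two key)
    have cD: "sum c D = sum c (D - P) + sum c P" using P(1) fin[OF DE] by (simp add: sum.subset_diff)
    have "cut_edges D K = cut_edges J K" using F'_cut by (auto simp: D_def cut_edges_def)
    moreover have "cut_edges D K = cut_edges (D - P) K \<union> cut_edges P K"
      using P(1) by (auto simp: cut_edges_def)
    moreover have "card (cut_edges (D - P) K \<union> cut_edges P K) = card (cut_edges (D - P) K) + card (cut_edges P K)"
      using fin[OF DE] fin[OF PE] by (intro card_Un_disjoint) (auto simp: cut_edges_def)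
    ultimately have cc: "card (cut_edges J K) = card (cut_edges (D - P) K) + 1" using P(3) by simp
    have "sym_diff D F' = J" by (auto simp: D_def)
    then have "int (sum w J) = int (sum w F') + sum c D" using cost[OF DE] by simp
    then show ?thesis using cP cR cD cc by linarith
  qed
  then show ?thesis using KV odd cut_pos by blast
qed

section \<open>Minimum joins against fractional cut covers\<close>

theorem join_weight_le_nat:
  fixes w :: "'a set \<Rightarrow> nat" and y :: "'a set \<Rightarrow> real"
  assumes "finite V" and EV: "E \<subseteq> complete_edges V"
    and join: "\<exists>J\<subseteq>E. odd_vertices J = T"
    and y_nonneg: "\<And>e. e \<in> E \<Longrightarrow> 0 \<le> y e"
    and y_cut: "\<And>S. S \<subseteq> V \<Longrightarrow> odd (card (S \<inter> T)) \<Longrightarrow> 1 \<le> sum y (cut_edges E S)"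
    and cycles: "\<And>X. X \<subseteq> E \<Longrightarrow> odd_vertices X = {} \<Longrightarrow> even (sum w X)"
  shows "\<exists>J\<subseteq>E. odd_vertices J = T \<and> real (sum w J) \<le> (\<Sum>e\<in>E. real (w e) * y e)"
  using cycles
proof (induction "sum w E" arbitrary: w rule: less_induct)
  case less
  have fE: "finite E" using EV assms(1) finite_complete_edges finite_subset by blast
  have fin: "finite X" if "X \<subseteq> E" for X using that fE finite_subset by blast
  have two: "card e = 2" if "e \<in> E" for e using that EV by (auto simp: complete_edges_def)
  obtain J0 where J0: "J0 \<subseteq> E \<and> odd_vertices J0 = T" using join by blast
  obtain F where F: "F \<subseteq> E" "odd_vertices F = T"
    and F_min: "\<And>J. J \<subseteq> E \<Longrightarrow> odd_vertices J = T \<Longrightarrow> sum w F \<le> sum w J"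
    using ex_has_least_nat[of "\<lambda>J. J \<subseteq> E \<and> odd_vertices J = T" J0 "sum w", OF J0] by metis
  show ?case
  proof (cases "sum w F = 0")
    case True
    have "0 \<le> (\<Sum>e\<in>E. real (w e) * y e)" using y_nonneg by (intro sum_nonneg) auto
    then show ?thesis using F True by (intro exI[of _ F]) simp
  next
    case False
    then have "sum w F > 0" by simp
    then obtain K where K: "K \<subseteq> V" "odd (card (K \<inter> T))"
      and pos: "\<And>e. e \<in> cut_edges E K \<Longrightarrow> 0 < w e"
      and once: "\<And>J. J \<subseteq> E \<Longrightarrow> odd_vertices J = T \<Longrightarrow> sum w F + card (cut_edges J K) \<le> sum w J + 1"
      using exists_odd_cut_met_once[OF assms(1) EV less.prems F _ F_min] by blast
    \<comment> \<open>Natural subtraction is harmless here because cut edges have positive weight.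
      The right-hand side drops by the \<open>y\<close>-value of the cut, at least 1, while the
      minimum drops by at most 1.\<close>
    define w' where "w' e = (if e \<in> cut_edges E K then w e - 1 else w e)" for e
    have w': "sum w X = sum w' X + card (cut_edges X K)" if X: "X \<subseteq> E" for X
    proof -
      have "sum w X = (\<Sum>e\<in>X. w' e + (if e \<in> cut_edges X K then 1 else 0))"
        using pos X by (intro sum.cong) (auto simp: w'_def cut_edges_def)
      also have "\<dots> = sum w' X + card (X \<inter> {e. e \<in> cut_edges X K})"
        using fin[OF X] by (simp add: sum.distrib sum.If_cases)
      also have "X \<inter> {e. e \<in> cut_edges X K} = cut_edges X K" by (auto simp: cut_edges_def)
      finally show ?thesis .
    qed
    have y1: "1 \<le> sum y (cut_edges E K)" using y_cut K by blast
    have fc: "finite (cut_edges E K)" using fE by (simp add: cut_edges_def)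
    have "cut_edges E K \<noteq> {}" using y1 by auto
    then have "card (cut_edges E K) > 0" using fc by (simp add: card_gt_0_iff)
    then have "sum w' E < sum w E" using w'[of E] by simp
    \<comment> \<open>An even subgraph meets every cut in an even number of edges, so the parity
      hypothesis survives the reduction.\<close>
    moreover have "even (sum w' X)" if X: "X \<subseteq> E" "odd_vertices X = {}" for X
    proof -
      have "even (card (cut_edges X K))"
        using odd_card_inter_odd_vertices[of X K] fin[OF X(1)] two X by auto
      then show ?thesis using less.prems[OF X] w'[OF X(1)] by simp
    qed
    ultimately obtain J where J: "J \<subseteq> E" "odd_vertices J = T"
      and le: "real (sum w' J) \<le> (\<Sum>e\<in>E. real (w' e) * y e)"
      using less.hyps[of w'] by blast
    have "sum w F \<le> sum w' J + 1" using once[OF J] w'[OF J(1)] by simp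
    then have "real (sum w F) \<le> (\<Sum>e\<in>E. real (w' e) * y e) + sum y (cut_edges E K)"
      using le y1 by linarith
    also have "\<dots> = (\<Sum>e\<in>E. real (w' e) * y e) + (\<Sum>e\<in>E. if e \<in> cut_edges E K then y e else 0)"
    proof -
      have "cut_edges E K = E \<inter> {e. e \<in> cut_edges E K}" by (auto simp: cut_edges_def)
      then show ?thesis using fE by (simp add: sum.If_cases)
    qed
    also have "\<dots> = (\<Sum>e\<in>E. real (w e) * y e)"
      unfolding sum.distrib[symmetric]
    proof (intro sum.cong refl)
      fix e
      show "real (w' e) * y e + (if e \<in> cut_edges E K then y e else 0) = real (w e) * y e"
        using pos[of e] by (auto simp: w'_def of_nat_diff algebra_simps)
    qed
    finally show ?thesis using F by blast
  qed
qed

text \<open>Rounding \<open>N * w\<close> up to integers and doubling makes the parity condition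
  automatic; the error is at most \<open>sum y E / N\<close>. The optimal join may vary with
  \<open>N\<close>, so the limit is taken for the minimum \<open>m\<close> over the finitely many
  joins.\<close>

lemma join_weight_le_real:
  fixes w y :: "'a set \<Rightarrow> real"
  assumes "finite V" and EV: "E \<subseteq> complete_edges V"
    and join: "\<exists>J\<subseteq>E. odd_vertices J = T"
    and y_nonneg: "\<And>e. e \<in> E \<Longrightarrow> 0 \<le> y e"
    and y_cut: "\<And>S. S \<subseteq> V \<Longrightarrow> odd (card (S \<inter> T)) \<Longrightarrow> 1 \<le> sum y (cut_edges E S)"
    and w_nonneg: "\<And>e. e \<in> E \<Longrightarrow> 0 \<le> w e"
  shows "\<exists>J\<subseteq>E. odd_vertices J = T \<and> sum w J \<le> (\<Sum>e\<in>E. w e * y e)"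
proof -
  have fE: "finite E" using EV assms(1) finite_complete_edges finite_subset by blast
  define A where "A = {J. J \<subseteq> E \<and> odd_vertices J = T}"
  have A: "finite A" "A \<noteq> {}" using fE join by (auto simp: A_def)
  define m where "m = Min (sum w ` A)"
  have m_in: "m \<in> sum w ` A" unfolding m_def using A by (intro Min_in) auto
  have m_le: "m \<le> sum w J" if "J \<in> A" for J unfolding m_def using A that by auto
  have approx: "m \<le> (\<Sum>e\<in>E. w e * y e) + sum y E / real N" if N: "N > 0" for N :: nat
  proof -
    define c where "c e = nat \<lceil>real N * w e\<rceil>" for e
    have c: "real N * w e \<le> real (c e)" "real (c e) \<le> real N * w e + 1" if "e \<in> E" for e
    proof -
      have "0 \<le> real N * w e" using w_nonneg[OF that] by simp
      then have "real (c e) = of_int \<lceil>real N * w e\<rceil>"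
        by (simp add: c_def)
      then show "real N * w e \<le> real (c e)" "real (c e) \<le> real N * w e + 1" by linarith+
    qed
    have "even (sum (\<lambda>e. 2 * c e) X)" for X by (intro dvd_sum) auto
    then obtain J where J: "J \<subseteq> E" "odd_vertices J = T"
      and le: "real (sum (\<lambda>e. 2 * c e) J) \<le> (\<Sum>e\<in>E. real (2 * c e) * y e)"
      using join_weight_le_nat[OF assms(1) EV join y_nonneg y_cut, of "\<lambda>e. 2 * c e"] by blast
    have "2 * (\<Sum>e\<in>J. real (c e)) \<le> 2 * (\<Sum>e\<in>E. real (c e) * y e)"
      using le by (simp add: sum_distrib_left mult.assoc)
    then have le': "(\<Sum>e\<in>J. real (c e)) \<le> (\<Sum>e\<in>E. real (c e) * y e)" by simp
    have "real N * m \<le> real N * sum w J" using m_le[of J] J by (intro mult_left_mono) (auto simp: A_def)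
    also have "\<dots> \<le> (\<Sum>e\<in>J. real (c e))"
      unfolding sum_distrib_left using c J by (intro sum_mono) auto
    also note le'
    also have "(\<Sum>e\<in>E. real (c e) * y e) \<le> (\<Sum>e\<in>E. (real N * w e + 1) * y e)"
      using c y_nonneg by (intro sum_mono mult_right_mono) auto
    also have "\<dots> = real N * (\<Sum>e\<in>E. w e * y e) + sum y E"
      by (simp add: algebra_simps sum.distrib sum_distrib_left)
    finally show ?thesis using N by (simp add: field_simps)
  qed
  have "m \<le> (\<Sum>e\<in>E. w e * y e)"
  proof (rule LIMSEQ_le_const)
    have "(\<lambda>N. (\<Sum>e\<in>E. w e * y e) + sum y E * (1 / real N)) \<longlonglongrightarrow> (\<Sum>e\<in>E. w e * y e) + sum y E * 0"
      by (intro tendsto_intros lim_1_over_n)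
    then show "(\<lambda>N. (\<Sum>e\<in>E. w e * y e) + sum y E / real N) \<longlonglongrightarrow> (\<Sum>e\<in>E. w e * y e)" by simp
    show "\<exists>N. \<forall>n\<ge>N. m \<le> (\<Sum>e\<in>E. w e * y e) + sum y E / real n"
      using approx by (intro exI[of _ 1]) auto
  qed
  then show ?thesis using m_in by (auto simp: A_def)
qed

subsection \<open>The dominant of the join polytope\<close>

text \<open>This bounds the squared positive part after a step \<open>h\<close> by a quadratic in
  \<open>h\<close>, so no case split on signs is needed when a descent step is expanded.\<close>

lemma max_0_add_square_le: "(max 0 (s + h))\<^sup>2 \<le> (max 0 s + h)\<^sup>2" for s h :: real
proof (cases "0 \<le> s")
  case True
  then show ?thesis by (auto simp: max_def)
next
  case False
  then show ?thesis by (auto simp: max_def intro: power_mono)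
qed

text \<open>A closed subset of a product of compact sets: coordinates outside \<open>I\<close> are
  pinned to 0, so the product over the whole index type is compact.\<close>

lemma compact_simplex:
  fixes I :: "'i set"
  assumes "finite I"
  shows "compact {l :: 'i \<Rightarrow> real. (\<forall>i\<in>I. 0 \<le> l i \<and> l i \<le> 1) \<and> (\<forall>i. i \<notin> I \<longrightarrow> l i = 0) \<and> sum l I = 1}"
proof -
  let ?B = "\<lambda>i. if i \<in> I then {0..1} else {0 :: real}"
  have "compactin (product_topology (\<lambda>i. euclidean) UNIV) (PiE UNIV ?B)"
    unfolding compactin_PiE by auto
  then have "compact (PiE UNIV ?B)" by (simp add: euclidean_product_topology)
  moreover have "closed {l :: 'i \<Rightarrow> real. sum l I = 1}"
    by (intro closed_Collect_eq continuous_intros continuous_on_product_coordinates)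
  ultimately have "compact (PiE UNIV ?B \<inter> {l. sum l I = 1})" by (rule compact_Int_closed)
  moreover have "PiE UNIV ?B \<inter> {l. sum l I = 1} =
    {l. (\<forall>i\<in>I. 0 \<le> l i \<and> l i \<le> 1) \<and> (\<forall>i. i \<notin> I \<longrightarrow> l i = 0) \<and> sum l I = 1}"
    by (auto simp: PiE_def Pi_def split: if_splits)
  ultimately show ?thesis by simp
qed

text \<open>The combination minimising the squared violation of \<open>\<Sum>\<^sub>i l i * a i \<le> y\<close> has zero violation:
  otherwise the violation itself is a weight \<open>w\<close> contradicting the hypothesis.\<close>

lemma dominated_convex_combination:
  fixes a :: "'i \<Rightarrow> 'e \<Rightarrow> real" and y :: "'e \<Rightarrow> real"
  assumes "finite I" "finite E"
    and weights: "\<And>w. (\<And>e. e \<in> E \<Longrightarrow> 0 \<le> w e) \<Longrightarrow> \<exists>i\<in>I. (\<Sum>e\<in>E. w e * a i e) \<le> (\<Sum>e\<in>E. w e * y e)"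
  shows "\<exists>l. (\<forall>i\<in>I. 0 \<le> l i) \<and> sum l I = 1 \<and> (\<forall>e\<in>E. (\<Sum>i\<in>I. l i * a i e) \<le> y e)"
proof -
  define L where "L = {l :: 'i \<Rightarrow> real. (\<forall>i\<in>I. 0 \<le> l i \<and> l i \<le> 1) \<and> (\<forall>i. i \<notin> I \<longrightarrow> l i = 0) \<and> sum l I = 1}"
  define z where "z l e = (\<Sum>i\<in>I. l i * a i e)" for l e
  define f where "f l = (\<Sum>e\<in>E. (max 0 (z l e - y e))\<^sup>2)" for l
  have cL: "compact L" unfolding L_def by (rule compact_simplex[OF assms(1)])
  obtain i0 where i0: "i0 \<in> I" using weights[of "\<lambda>_. 0"] by auto
  have "(\<lambda>i. if i = i0 then 1 else 0) \<in> L" using i0 assms(1) by (auto simp: L_def)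
  then have "L \<noteq> {}" by blast
  moreover have "continuous_on L f" unfolding f_def z_def
    by (intro continuous_intros continuous_on_product_then_coordinatewise[OF continuous_on_id])
  ultimately obtain l where l: "l \<in> L" and l_min: "\<And>k. k \<in> L \<Longrightarrow> f l \<le> f k"
    using continuous_attains_inf[OF cL] by blast
  define p where "p e = max 0 (z l e - y e)" for e
  \<comment> \<open>First-order optimality: up to a factor 2 this is the slope of \<open>f\<close>
    at \<open>l\<close> towards the vertex \<open>j\<close> of the simplex. A negative slope would
    let a short step decrease \<open>f\<close>.\<close>
  have grad: "0 \<le> (\<Sum>e\<in>E. p e * (a j e - z l e))" if j: "j \<in> I" for j
  proof (rule ccontr)
    define d where "d e = a j e - z l e" for e
    define g where "g = - (\<Sum>e\<in>E. p e * d e)"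
    define q where "q = (\<Sum>e\<in>E. (d e)\<^sup>2)"
    assume "\<not> ?thesis"
    then have g: "g > 0" by (simp add: g_def d_def)
    have q: "q \<ge> 0" unfolding q_def by (intro sum_nonneg) auto
    \<comment> \<open>The step is at most 1, to stay in the simplex, and so short that the quadratic
      term \<open>t\<^sup>2 * q\<close> is at most half the linear gain \<open>2 * t * g\<close>.
      The denominator \<open>q + 1\<close> also covers \<open>q = 0\<close>.\<close>
    define t where "t = min 1 (g / (q + 1))"
    have t: "0 < t" "t \<le> 1" "t * q \<le> g"
    proof -
      show "0 < t" "t \<le> 1" using g q by (auto simp: t_def)
      have "t * q \<le> g / (q + 1) * q" using q by (intro mult_right_mono) (auto simp: t_def)
      also have "\<dots> \<le> g" using g q by (simp add: field_simps)
      finally show "t * q \<le> g" .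
    qed
    define k where "k i = (1 - t) * l i + (if i = j then t else 0)" for i
    have sk: "sum k I = 1" using l j assms(1)
      by (simp add: k_def L_def sum.distrib sum_distrib_left[symmetric])
    have k0: "0 \<le> k i" if "i \<in> I" for i using l that t by (auto simp: k_def L_def)
    have k1: "k i \<le> 1" if "i \<in> I" for i
      using member_le_sum[of i I k] k0 assms(1) that sk by auto
    have kL: "k \<in> L" using sk k0 k1 j l by (auto simp: L_def k_def)
    have zk: "z k e = z l e + t * d e" for e
    proof -
      have "z k e = (\<Sum>i\<in>I. (1 - t) * (l i * a i e) + (if i = j then t * a i e else 0))"
        unfolding z_def k_def by (intro sum.cong) (auto simp: algebra_simps)
      also have "\<dots> = (1 - t) * z l e + t * a j e"
        using j assms(1) by (simp add: sum.distrib sum_distrib_left[symmetric] z_def)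
      finally show ?thesis by (simp add: d_def algebra_simps)
    qed
    have "f l \<le> f k" by (rule l_min[OF kL])
    also have "f k \<le> (\<Sum>e\<in>E. (p e + t * d e)\<^sup>2)"
      unfolding f_def
    proof (rule sum_mono)
      fix e
      show "(max 0 (z k e - y e))\<^sup>2 \<le> (p e + t * d e)\<^sup>2"
        using max_0_add_square_le[of "z l e - y e" "t * d e"] by (simp add: zk p_def algebra_simps)
    qed
    also have "\<dots> = f l + 2 * t * (\<Sum>e\<in>E. p e * d e) + t\<^sup>2 * q"
      by (simp add: f_def p_def[symmetric] q_def power2_sum sum.distrib sum_distrib_left
          power_mult_distrib algebra_simps)
    finally have "0 \<le> t * (- 2 * g + t * q)" by (simp add: g_def power2_eq_square algebra_simps)
    then have "0 \<le> - 2 * g + t * q" using t(1) by (simp add: zero_le_mult_iff)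
    then show False using t g by simp
  qed
  obtain j where j: "j \<in> I" "(\<Sum>e\<in>E. p e * a j e) \<le> (\<Sum>e\<in>E. p e * y e)"
    using weights[of p] by (auto simp: p_def)
  \<comment> \<open>Where \<open>p e\<close> is nonzero it equals \<open>z l e - y e\<close>.
    Splitting through \<open>a j\<close> bounds the squared norm of \<open>p\<close> by the choice
    of \<open>j\<close> and by \<open>grad\<close>.\<close>
  have "(\<Sum>e\<in>E. (p e)\<^sup>2) = (\<Sum>e\<in>E. p e * (z l e - y e))"
    by (intro sum.cong) (auto simp: p_def max_def power2_eq_square)
  also have "\<dots> = (\<Sum>e\<in>E. p e * a j e) - (\<Sum>e\<in>E. p e * y e) - (\<Sum>e\<in>E. p e * (a j e - z l e))"
    by (simp add: sum_subtractf[symmetric] algebra_simps)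
  also have "\<dots> \<le> 0" using j grad[OF j(1)] by linarith
  finally have "(\<Sum>e\<in>E. (p e)\<^sup>2) = 0" by (intro antisym sum_nonneg) auto
  then have "p e = 0" if "e \<in> E" for e using that assms(2) by (simp add: sum_nonneg_eq_0_iff)
  then have "\<forall>e\<in>E. z l e \<le> y e" by (force simp: p_def max_def split: if_splits)
  then show ?thesis using l by (intro exI[of _ l]) (auto simp: L_def z_def)
qed

text \<open>The substantial direction of Edmonds--Johnson: the odd-cut inequalities place
  \<open>y\<close> in the dominant of the join polytope. For each weight
  \<open>join_weight_le_real\<close> gives a join no heavier than \<open>y\<close>, and
  \<open>dominated_convex_combination\<close> merges these into a single combination.\<close>

theorem join_polyhedron:
  fixes y :: "'a set \<Rightarrow> real"
  assumes "finite V" and EV: "E \<subseteq> complete_edges V"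
    and join: "\<exists>J\<subseteq>E. odd_vertices J = T"
    and y_nonneg: "\<And>e. e \<in> E \<Longrightarrow> 0 \<le> y e"
    and y_cut: "\<And>S. S \<subseteq> V \<Longrightarrow> odd (card (S \<inter> T)) \<Longrightarrow> 1 \<le> sum y (cut_edges E S)"
  shows "\<exists>l. (\<forall>J\<in>{J. J \<subseteq> E \<and> odd_vertices J = T}. 0 \<le> l J) \<and>
    sum l {J. J \<subseteq> E \<and> odd_vertices J = T} = 1 \<and>
    (\<forall>e\<in>E. (\<Sum>J | J \<subseteq> E \<and> odd_vertices J = T. l J * indicator J e) \<le> y e)"
proof (rule dominated_convex_combination)
  show fE: "finite E" using EV assms(1) finite_complete_edges finite_subset by blast
  then show "finite {J. J \<subseteq> E \<and> odd_vertices J = T}" by simp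
  fix w :: "'a set \<Rightarrow> real" assume w: "\<And>e. e \<in> E \<Longrightarrow> 0 \<le> w e"
  have "\<exists>J\<subseteq>E. odd_vertices J = T \<and> sum w J \<le> (\<Sum>e\<in>E. w e * y e)"
    by (rule join_weight_le_real[OF assms w])
  then obtain J where J: "J \<subseteq> E" "odd_vertices J = T" "sum w J \<le> (\<Sum>e\<in>E. w e * y e)"
    by blast
  moreover have "(\<Sum>e\<in>E. w e * indicator J e) = sum w J"
    using fE J(1) by (simp add: indicator_def if_distrib sum.If_cases Int_absorb1 cong: if_cong)
  ultimately have "(\<Sum>e\<in>E. w e * indicator J e) \<le> (\<Sum>e\<in>E. w e * y e)" by simp
  with J(1,2) show "\<exists>J\<in>{J. J \<subseteq> E \<and> odd_vertices J = T}.
      (\<Sum>e\<in>E. w e * indicator J e) \<le> (\<Sum>e\<in>E. w e * y e)" by blast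
qed

subsection \<open>Tours\<close>

lemma finite_E\<^sub>K: "finite (E\<^sub>K n)"
  by (simp add: E\<^sub>K_def V\<^sub>K_def finite_complete_edges)

lemma E\<^sub>K_subset: "E\<^sub>K n \<subseteq> complete_edges (V\<^sub>K n)"
  by (simp add: E\<^sub>K_def)

lemma finite_V\<^sub>K: "finite (V\<^sub>K n)"
  by (simp add: V\<^sub>K_def)

lemma card_E\<^sub>K: "e \<in> E\<^sub>K n \<Longrightarrow> card e = 2"
  by (simp add: E\<^sub>K_def complete_edges_def)

lemma convex_T_polyhedron: "convex (T_polyhedron n)"
  by (simp add: T_polyhedron_def)

lemma multi_incidence_in_T: "tour n J \<Longrightarrow> multi_incidence J \<in> T_polyhedron n"
  unfolding T_polyhedron_def by (rule hull_inc) blast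

lemma connected_graph_mono: "connected_graph V E \<Longrightarrow> E \<subseteq> E' \<Longrightarrow> connected_graph V E'"
proof -
  assume "connected_graph V E" "E \<subseteq> E'"
  moreover have "{(a, b). {a, b} \<in> E}\<^sup>* \<subseteq> {(a, b). {a, b} \<in> E'}\<^sup>*"
    using \<open>E \<subseteq> E'\<close> by (intro rtrancl_mono) auto
  ultimately show ?thesis unfolding connected_graph_def by blast
qed

lemma tour_double_edge:
  assumes "tour n J" "e \<in> E\<^sub>K n"
  shows "tour n (J + replicate_mset (2 * k) e)"
proof -
  have "set_mset J \<subseteq> set_mset (J + replicate_mset (2 * k) e)" by simp
  then have "connected_graph (V\<^sub>K n) (set_mset (J + replicate_mset (2 * k) e))"
    using assms(1) connected_graph_mono unfolding tour_def by blast
  moreover have "even (size (filter_mset (\<lambda>e. v \<in> e) (replicate_mset (2 * k) e)))" for v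
    by (induction k) auto
  ultimately show ?thesis using assms unfolding tour_def by auto
qed

text \<open>The preimage \<open>Q\<close> of a convex set under translation is convex, so tours
  suffice. For a tour the shifted point lies on the segment towards the same tour with
  \<open>2 * k\<close> further copies of \<open>e\<close>, once \<open>k\<close> exceeds
  \<open>r\<close>.\<close>

lemma T_polyhedron_add_edge:
  assumes "e \<in> E\<^sub>K n" "0 \<le> r" "t \<in> T_polyhedron n"
  shows "(\<lambda>d. t d + r * indicator {e} d) \<in> T_polyhedron n"
proof -
  define Q where "Q = {t. (\<lambda>d. t d + r * indicator {e} d) \<in> T_polyhedron n}"
  have "convex Q"
    unfolding convex_def
  proof (intro ballI allI impI)
    fix a b :: "nat set \<Rightarrow> real" and u v :: real
    assume a: "a \<in> Q" and b: "b \<in> Q" and uv: "0 \<le> u" "0 \<le> v" "u + v = 1"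
    have "u *\<^sub>R (\<lambda>d. a d + r * indicator {e} d) + v *\<^sub>R (\<lambda>d. b d + r * indicator {e} d) \<in> T_polyhedron n"
      using a b uv convex_T_polyhedron[of n] unfolding Q_def convex_def by simp
    moreover have "u *\<^sub>R (\<lambda>d. a d + r * indicator {e} d) + v *\<^sub>R (\<lambda>d. b d + r * indicator {e} d) =
        (\<lambda>d. (u *\<^sub>R a + v *\<^sub>R b) d + r * indicator {e} d)"
    proof
      fix d
      have "u * (r * indicator {e} d) + v * (r * indicator {e} d) = (r * indicator {e} d :: real)"
        using uv(3) by (metis mult_1 distrib_right)
      then show "(u *\<^sub>R (\<lambda>d. a d + r * indicator {e} d) + v *\<^sub>R (\<lambda>d. b d + r * indicator {e} d)) d =
          (u *\<^sub>R a + v *\<^sub>R b) d + r * indicator {e} d"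
        by (simp add: algebra_simps)
    qed
    ultimately show "u *\<^sub>R a + v *\<^sub>R b \<in> Q" by (simp add: Q_def)
  qed
  moreover have "{multi_incidence J | J. tour n J} \<subseteq> Q"
  proof clarify
    fix J assume J: "tour n J"
    obtain k :: nat where k: "r < real k" using reals_Archimedean2 by blast
    then have k0: "0 < k" using assms(2) by (cases k) auto
    let ?m = "multi_incidence (J + replicate_mset (2 * k) e)"
    let ?s = "r / (2 * real k)"
    have s: "0 \<le> ?s" "?s \<le> 1" using assms(2) k k0 by (auto simp: field_simps)
    have "(1 - ?s) *\<^sub>R multi_incidence J + ?s *\<^sub>R ?m \<in> T_polyhedron n"
      using convexD[OF convex_T_polyhedron[of n] multi_incidence_in_T[OF J]
          multi_incidence_in_T[OF tour_double_edge[OF J assms(1), of k]], of "1 - ?s" ?s] s by simp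
    moreover have "(1 - ?s) *\<^sub>R multi_incidence J + ?s *\<^sub>R ?m =
        (\<lambda>d. multi_incidence J d + r * indicator {e} d)"
      using k0 by (auto simp: fun_eq_iff multi_incidence_def indicator_def field_simps)
    ultimately show "multi_incidence J \<in> Q" by (simp add: Q_def)
  qed
  ultimately have "T_polyhedron n \<subseteq> Q" unfolding T_polyhedron_def by (rule hull_minimal[rotated])
  then show ?thesis using assms(3) by (auto simp: Q_def)
qed

lemma T_polyhedron_upward:
  assumes "t \<in> T_polyhedron n" "\<And>e. e \<in> E\<^sub>K n \<Longrightarrow> t e \<le> s e" "\<And>e. e \<notin> E\<^sub>K n \<Longrightarrow> s e = t e"
  shows "s \<in> T_polyhedron n"
proof -
  have "(\<lambda>d. if d \<in> X then s d else t d) \<in> T_polyhedron n" if "finite X" "X \<subseteq> E\<^sub>K n" for X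
    using that
  proof (induction X rule: finite_induct)
    case empty
    then show ?case using assms(1) by simp
  next
    case (insert e X)
    have "(\<lambda>d. (if d \<in> X then s d else t d) + (s e - t e) * indicator {e} d) \<in> T_polyhedron n"
      using insert assms(2) by (intro T_polyhedron_add_edge) auto
    moreover have "(\<lambda>d. (if d \<in> X then s d else t d) + (s e - t e) * indicator {e} d) =
        (\<lambda>d. if d \<in> insert e X then s d else t d)"
      using insert.hyps by (auto simp: fun_eq_iff indicator_def)
    ultimately show ?case by simp
  qed
  from this[OF finite_E\<^sub>K subset_refl]
  have "(\<lambda>d. if d \<in> E\<^sub>K n then s d else t d) \<in> T_polyhedron n" .
  moreover have "(\<lambda>d. if d \<in> E\<^sub>K n then s d else t d) = s" using assms(3) by (auto simp: fun_eq_iff)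
  ultimately show ?thesis by simp
qed

text \<open>The multiset sum counts a common edge of \<open>F\<close> and \<open>J\<close> twice.
  Degrees therefore add exactly, and equal parities in \<open>F\<close> and \<open>J\<close> make
  every total even.\<close>

lemma tour_mset_set_plus_join:
  assumes "F \<subseteq> E\<^sub>K n" "J \<subseteq> E\<^sub>K n" "connected_graph (V\<^sub>K n) F" "odd_vertices F = odd_vertices J"
  shows "tour n (mset_set F + mset_set J)"
proof -
  have fin: "finite F" "finite J" using assms finite_E\<^sub>K finite_subset by blast+
  have "even (size {#e \<in># mset_set F + mset_set J. v \<in> e#})" for v
    using assms(4) fin by (auto simp: odd_vertices_def filter_mset_mset_set set_eq_iff)
  moreover have "connected_graph (V\<^sub>K n) (F \<union> J)" using connected_graph_mono[OF assms(3)] by auto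
  ultimately show ?thesis using assms fin by (auto simp: tour_def)
qed

lemma sum_fun_apply: "(\<Sum>i\<in>I. f i) x = (\<Sum>i\<in>I. f i x)" for f :: "'i \<Rightarrow> 'a \<Rightarrow> real"
  by (induction I rule: infinite_finite_induct) (auto simp: zero_fun_def)

text \<open>By the handshake identity, the cuts meeting \<open>F\<close> oddly are those odd for
  \<open>T = odd_vertices F\<close>, so \<open>y\<close> dominates a combination of joins
  \<open>J\<close> for this \<open>T\<close>. Each \<open>F\<close> plus \<open>J\<close> is a tour,
  and upward closure of the polyhedron fills the gap up to \<open>y\<close>.\<close>

lemma connected_plus_cut_dominator_in_T:
  assumes F: "F \<subseteq> E\<^sub>K n" "connected_graph (V\<^sub>K n) F"
    and y_nonneg: "\<And>e. e \<in> E\<^sub>K n \<Longrightarrow> 0 \<le> y e"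
    and y_zero: "\<And>e. e \<notin> E\<^sub>K n \<Longrightarrow> y e = 0"
    and y_cut: "\<And>S. S \<subseteq> V\<^sub>K n \<Longrightarrow> odd (card (cut_edges F S)) \<Longrightarrow> 1 \<le> sum y (cut_edges (E\<^sub>K n) S)"
  shows "(\<lambda>e. indicator F e + y e) \<in> T_polyhedron n"
proof -
  define A where "A = {J. J \<subseteq> E\<^sub>K n \<and> odd_vertices J = odd_vertices F}"
  have fin: "finite F" "finite A" using finite_subset[OF F(1)] finite_E\<^sub>K by (auto simp: A_def)
  have "1 \<le> sum y (cut_edges (E\<^sub>K n) S)" if "S \<subseteq> V\<^sub>K n" "odd (card (S \<inter> odd_vertices F))" for S
    using y_cut[OF that(1)] odd_card_inter_odd_vertices[OF fin(1), of S] card_E\<^sub>K F(1) that(2) by blast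
  \<comment> \<open>\<open>F\<close> itself witnesses that a join for its odd vertices
    exists.\<close>
  then have "\<exists>l. (\<forall>J\<in>A. 0 \<le> l J) \<and> sum l A = 1 \<and>
      (\<forall>e\<in>E\<^sub>K n. (\<Sum>J\<in>A. l J * indicator J e) \<le> y e)"
    unfolding A_def using F(1) y_nonneg
    by (intro join_polyhedron[OF finite_V\<^sub>K E\<^sub>K_subset]) auto
  then obtain l where l: "\<forall>J\<in>A. 0 \<le> l J" "sum l A = 1"
      "\<forall>e\<in>E\<^sub>K n. (\<Sum>J\<in>A. l J * indicator J e) \<le> y e"
    by blast
  let ?m = "\<lambda>J. multi_incidence (mset_set F + mset_set J)"
  have m: "?m J e = indicator F e + indicator J e" if "J \<in> A" for J e
    using that fin finite_subset[OF _ finite_E\<^sub>K, of J n]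
    by (auto simp: A_def multi_incidence_def count_mset_set' indicator_def)
  have in_T: "(\<Sum>J\<in>A. l J *\<^sub>R ?m J) \<in> T_polyhedron n"
    using l(1,2) fin(2) F
    by (intro convex_sum convex_T_polyhedron multi_incidence_in_T tour_mset_set_plus_join)
      (auto simp: A_def)
  have comb: "(\<Sum>J\<in>A. l J *\<^sub>R ?m J) e = indicator F e + (\<Sum>J\<in>A. l J * indicator J e)" for e
  proof -
    have "(\<Sum>J\<in>A. l J *\<^sub>R ?m J) e = (\<Sum>J\<in>A. l J * indicator F e + l J * indicator J e)"
      unfolding sum_fun_apply by (intro sum.cong refl) (simp add: m distrib_left)
    also have "\<dots> = sum l A * indicator F e + (\<Sum>J\<in>A. l J * indicator J e)"
      by (simp add: sum.distrib sum_distrib_right)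
    finally show ?thesis using l(2) by simp
  qed
  have zero: "(\<Sum>J\<in>A. l J * indicator J e) = 0" if "e \<notin> E\<^sub>K n" for e
    using that by (intro sum.neutral) (auto simp: A_def indicator_def)
  show ?thesis
  proof (rule T_polyhedron_upward[OF in_T])
    show "(\<Sum>J\<in>A. l J *\<^sub>R ?m J) e \<le> indicator F e + y e" if "e \<in> E\<^sub>K n" for e
      unfolding comb using l(3) that by simp
    show "indicator F e + y e = (\<Sum>J\<in>A. l J *\<^sub>R ?m J) e" if "e \<notin> E\<^sub>K n" for e
      unfolding comb zero[OF that] using y_zero[OF that] by simp
  qed
qed

section \<open>Connectivity and degrees of 1-trees and cycles\<close>

lemma one_tree_connected:
  assumes "one_tree n F"
  shows "connected_graph (V\<^sub>K n) F"
proof -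
  let ?R = "{(a, b). {a, b} \<in> F}"
  have "card (F \<inter> cut_edges (E\<^sub>K n) {1}) \<noteq> 0" using assms by (simp add: one_tree_def)
  then obtain e where e: "e \<in> F" "e \<in> cut_edges (E\<^sub>K n) {1}" by (metis Int_iff card.empty ex_in_conv)
  then have "card e = 2" "card (e \<inter> {1}) = 1" "e \<subseteq> V\<^sub>K n"
    by (auto simp: cut_edges_def E\<^sub>K_def complete_edges_def)
  then obtain b where b: "e = {1, b}" "b \<noteq> 1" "b \<in> V\<^sub>K n"
    using card_2_cut by (metis insert_subset singletonD singletonI)
  have tree: "(u, v) \<in> ?R\<^sup>*" if "u \<in> V\<^sub>K n - {1}" "v \<in> V\<^sub>K n - {1}" for u v
  proof -
    have "connected_graph (V\<^sub>K n - {1}) F"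
      using assms unfolding one_tree_def spanning_tree_on_def
      by (elim conjE) (rule connected_graph_mono, auto)
    then show ?thesis using that unfolding connected_graph_def by blast
  qed
  have "sym (?R\<^sup>*)" by (intro sym_rtrancl) (auto simp: sym_def insert_commute)
  moreover have one: "(1, v) \<in> ?R\<^sup>*" if "v \<in> V\<^sub>K n" for v
  proof (cases "v = 1")
    case False
    have "(1, b) \<in> ?R\<^sup>*" using e b by auto
    then show ?thesis using tree[of b v] b that False by (meson DiffI rtrancl_trans singletonD)
  qed simp
  ultimately show ?thesis unfolding connected_graph_def by (meson rtrancl_trans symD)
qed

lemma closed_walk_odd_vertices:
  assumes "3 \<le> length vs" "distinct vs"
  shows "odd_vertices (closed_walk_edges vs) = {}"
proof -
  let ?m = "length vs"
  define ed where "ed i = {vs ! i, vs ! (Suc i mod ?m)}" for i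
  have H: "closed_walk_edges vs = ed ` {..<?m}" by (auto simp: closed_walk_edges_def ed_def)
  have nth: "vs ! i = vs ! j \<longleftrightarrow> i = j" if "i < ?m" "j < ?m" for i j
    using nth_eq_iff_index_eq[OF assms(2)] that by blast
  have ml: "Suc i mod ?m < ?m" for i using assms(1) by (intro mod_less_divisor) linarith
  have S: "Suc i mod ?m = (if Suc i = ?m then 0 else Suc i)" if "i < ?m" for i
    using that by auto
  have inj: "inj_on ed {..<?m}"
  proof (rule inj_onI)
    fix i j assume ij: "i \<in> {..<?m}" "j \<in> {..<?m}" "ed i = ed j"
    \<comment> \<open>Two edges could also agree crosswise, each index being the successor of the
      other; a length of at least 3 rules this out.\<close>
    then have "(i = j \<and> Suc i mod ?m = Suc j mod ?m) \<or> (i = Suc j mod ?m \<and> Suc i mod ?m = j)"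
      unfolding ed_def doubleton_eq_iff using nth ml by simp
    then show "i = j" using ij(1,2) S assms(1) by (auto split: if_splits)
  qed
  have "even (card {e \<in> closed_walk_edges vs. v \<in> e})" for v
  proof (cases "v \<in> set vs")
    case False
    then have "{e \<in> closed_walk_edges vs. v \<in> e} = {}"
      using ml assms(1) unfolding H ed_def by (auto simp: in_set_conv_nth)
    then show ?thesis by (simp only: card.empty even_zero)
  next
    case True
    then obtain j where j: "j < ?m" "v = vs ! j" by (metis in_set_conv_nth)
    \<comment> \<open>\<open>p\<close> is the cyclic predecessor of \<open>j\<close>, so the two
      edges at \<open>v\<close> are \<open>ed j\<close> and \<open>ed p\<close>.\<close>
    define p where "p = (if j = 0 then ?m - 1 else j - 1)"
    have p: "p < ?m" "p \<noteq> j" using j assms(1) by (auto simp: p_def)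
    have "v \<in> ed i \<longleftrightarrow> i = j \<or> i = p" if "i < ?m" for i
      using that j nth[of j i] nth[of j "Suc i mod ?m"] ml[of i] S[OF that] assms(1)
      by (auto simp: ed_def p_def split: if_splits)
    then have "{e \<in> closed_walk_edges vs. v \<in> e} = ed ` {j, p}"
      using j p unfolding H by blast
    moreover have "card (ed ` {j, p}) = card {j, p}"
      using j p by (intro card_image inj_on_subset[OF inj]) auto
    ultimately show ?thesis using p by simp
  qed
  then show ?thesis by (auto simp: odd_vertices_def)
qed

lemma closed_walk_connected: "connected_graph (set vs) (closed_walk_edges vs)"
proof -
  let ?R = "{(a, b). {a, b} \<in> closed_walk_edges vs}"
  have "(vs ! 0, vs ! i) \<in> ?R\<^sup>*" if "i < length vs" for i
    using that
  proof (induction i)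
    case (Suc i)
    then have "{vs ! i, vs ! Suc i} \<in> closed_walk_edges vs"
      by (force simp: closed_walk_edges_def)
    then show ?case using Suc by (auto intro: rtrancl_into_rtrancl)
  qed simp
  then have "(vs ! 0, v) \<in> ?R\<^sup>*" if "v \<in> set vs" for v using that by (metis in_set_conv_nth)
  moreover have "sym (?R\<^sup>*)" by (intro sym_rtrancl) (auto simp: sym_def insert_commute)
  ultimately show ?thesis unfolding connected_graph_def by (meson rtrancl_trans symD)
qed

section \<open>The cut inequality and the final combination\<close>

lemma half_integer_cut_bound:
  fixes x :: "'e \<Rightarrow> real"
  assumes "finite C" "h \<subseteq> C" "even (card h)" "\<And>e. e \<in> C \<Longrightarrow> x e = 1/2 \<or> x e = 1" "2 \<le> sum x C"
    and not_bad: "\<not> (card C = 4 \<and> (\<forall>e\<in>C. x e = 1/2 \<and> e \<in> h))"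
  shows "1 \<le> 2/3 * sum x C - 1/6 * real (card h)"
proof -
  have hC: "card h \<le> card C" using assms(1,2) card_mono by blast
  have "(\<Sum>e\<in>C. 1/2) \<le> sum x C" using assms(4) by (intro sum_mono) force
  then have half: "real (card C) \<le> 2 * sum x C" by simp
  show ?thesis
  proof (rule ccontr)
    assume "\<not> ?thesis"
    \<comment> \<open>Since \<open>card h \<le> card C \<le> 2 * sum x C\<close>, this forces
      \<open>card h < 6\<close>, and \<open>sum x C \<ge> 2\<close> forces
      \<open>card h > 2\<close>; parity leaves 4. Then \<open>sum x C < 5/2\<close> leaves room for
      only four edges.\<close>
    then have less: "4 * sum x C < 6 + real (card h)" by simp
    then have "real (card h) < 6" using half hC by linarith
    moreover have "real (card h) > 2" using less assms(5) by linarith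
    ultimately have "card h = 3 \<or> card h = 4 \<or> card h = 5" by linarith
    then have "card h = 4" using assms(3) by auto
    then have c: "sum x C < 5/2" using less by simp
    then have "card C = 4" using half hC \<open>card h = 4\<close> by linarith
    then have hC: "h = C" using assms(1,2) \<open>card h = 4\<close> by (simp add: card_subset_eq)
    have "x e = 1/2" if e: "e \<in> C" for e
    proof (rule ccontr)
      assume "x e \<noteq> 1/2"
      then have "x e = 1" using assms(4) e by blast
      \<comment> \<open>One edge of value 1 and three of value at least 1/2 would already reach
        5/2.\<close>
      have "(\<Sum>d\<in>C - {e}. 1/2) \<le> sum x (C - {e})" using assms(4) by (intro sum_mono) force
      then have "3/2 \<le> sum x (C - {e})" using \<open>card C = 4\<close> e assms(1) by simp
      then show False using c \<open>x e = 1\<close> e assms(1) by (simp add: sum.remove)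
    qed
    then show False using not_bad hC \<open>card C = 4\<close> by blast
  qed
qed

theorem theorem7:
  fixes n :: nat and x :: "nat set \<Rightarrow> real" and H :: "nat set set"
  assumes "n \<ge> 3"
    and "x \<in> S_polytope n"
    and "half_integer n x"
    and A: "hamiltonian_cycle (V\<^sub>K n) (support_edges n x) H"
    and B: "x \<in> convex hull {indicator F | F. one_tree n F \<and>
          (\<forall>S. S \<noteq> {} \<and> S \<subset> V\<^sub>K n \<and>
               card (cut_edges (support_edges n x) S) = 4 \<and>
               (\<forall>e\<in>cut_edges (support_edges n x) S. x e = 1/2 \<and> e \<in> H) \<longrightarrow>
               even (card (F \<inter> cut_edges (support_edges n x) S)))}"
  shows "(10/7) *\<^sub>R x \<in> T_polyhedron n"
proof -
  define G where "G = support_edges n x"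
  have GE: "G \<subseteq> E\<^sub>K n" by (auto simp: G_def support_edges_def)
  obtain vs where vs: "3 \<le> length vs" "distinct vs" "H \<subseteq> G" "set vs = V\<^sub>K n" "H = closed_walk_edges vs"
    using A unfolding hamiltonian_cycle_def cycle_in_def G_def by blast
  have H_even: "odd_vertices H = {}" using closed_walk_odd_vertices vs by blast
  have H_conn: "connected_graph (V\<^sub>K n) H" using closed_walk_connected vs by metis
  have fH: "finite H" by (rule finite_subset[OF subset_trans[OF vs(3) GE] finite_E\<^sub>K])
  have x_out: "x e = 0" if "e \<notin> G" for e
    using that assms(2,3) by (cases "e \<in> E\<^sub>K n") (auto simp: S_polytope_def half_integer_def G_def support_edges_def)
  have x_half: "x e = 1/2 \<or> x e = 1" if "e \<in> G" for e
    using that assms(3) by (auto simp: half_integer_def G_def support_edges_def)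
  \<comment> \<open>On \<open>H\<close> the value is at least 1/3 - 1/6 because \<open>x\<close> is
    at least 1/2 there. A cut of value 2 with two edges of \<open>H\<close> gets exactly 4/3 - 1/3 =
    1.\<close>
  define y where "y e = 2/3 * x e - 1/6 * indicator H e" for e
  have y_nonneg: "0 \<le> y e" for e
    using x_half[of e] x_out[of e] vs(3) by (cases "e \<in> G") (auto simp: y_def indicator_def)
  have y_out: "y e = 0" if "e \<notin> G" for e using x_out that vs(3) by (auto simp: y_def indicator_def)
  have y_cut: "1 \<le> sum y (cut_edges (E\<^sub>K n) S)"
    if S: "S \<noteq> {}" "S \<subset> V\<^sub>K n"
      and "\<not> (card (cut_edges G S) = 4 \<and> (\<forall>e\<in>cut_edges G S. x e = 1/2 \<and> e \<in> H))" for S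
  proof -
    have fin: "finite (cut_edges (E\<^sub>K n) S)" using finite_E\<^sub>K by (simp add: cut_edges_def)
    have sub: "cut_edges G S \<subseteq> cut_edges (E\<^sub>K n) S" using GE by (auto simp: cut_edges_def)
    have restrict: "sum f (cut_edges (E\<^sub>K n) S) = sum f (cut_edges G S)" if "\<And>e. e \<notin> G \<Longrightarrow> f e = 0"
      for f :: "nat set \<Rightarrow> real"
      using fin sub that by (intro sum.mono_neutral_right) (auto simp: cut_edges_def)
    have "even (card (cut_edges H S))"
      using odd_card_inter_odd_vertices[OF fH, of S] H_even vs(3) GE card_E\<^sub>K[where n = n]
      by (simp add: subset_iff)
    moreover have "2 \<le> sum x (cut_edges G S)"
    proof -
      have "2 \<le> sum x (cut_edges (E\<^sub>K n) S)" using assms(2) S unfolding S_polytope_def by blast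
      then show ?thesis using restrict[of x] x_out by simp
    qed
    moreover have "cut_edges H S \<subseteq> cut_edges G S" using vs(3) by (auto simp: cut_edges_def)
    moreover have "\<not> (card (cut_edges G S) = 4 \<and> (\<forall>e\<in>cut_edges G S. x e = 1/2 \<and> e \<in> cut_edges H S))"
      using that(3) unfolding cut_edges_def by blast
    moreover have "x e = 1/2 \<or> x e = 1" if "e \<in> cut_edges G S" for e
      using x_half[of e] that by (simp add: cut_edges_def)
    ultimately have "1 \<le> 2/3 * sum x (cut_edges G S) - 1/6 * real (card (cut_edges H S))"
      using finite_subset[OF sub fin] by (intro half_integer_cut_bound)
    also have "real (card (cut_edges H S)) = (\<Sum>e\<in>cut_edges G S. indicator H e)"
    proof -
      have "cut_edges H S = cut_edges G S \<inter> H" using vs(3) by (auto simp: cut_edges_def)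
      then show ?thesis using finite_subset[OF sub fin] by (simp add: indicator_def sum.If_cases)
    qed
    also have "2/3 * sum x (cut_edges G S) - 1/6 * (\<Sum>e\<in>cut_edges G S. indicator H e) =
        sum y (cut_edges G S)"
      by (simp add: y_def sum_subtractf sum_distrib_left)
    finally show ?thesis using restrict[of y] y_out by simp
  qed
  \<comment> \<open>The extra summand off the support covers the 1-trees that use an edge outside \<open>G\<^sub>x\<close>; it
    vanishes at \<open>x\<close>.\<close>
  define Q where "Q = {a. (\<lambda>e. a e + (y e + (if e \<in> G then 0 else a e))) \<in> T_polyhedron n}"
  have "convex Q"
    unfolding convex_def
  proof (intro ballI allI impI)
    fix a b :: "nat set \<Rightarrow> real" and u v :: real
    let ?g = "\<lambda>a e. a e + (y e + (if e \<in> G then 0 else a e))"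
    assume a: "a \<in> Q" and b: "b \<in> Q" and uv: "0 \<le> u" "0 \<le> v" "u + v = 1"
    have "u *\<^sub>R ?g a + v *\<^sub>R ?g b \<in> T_polyhedron n"
      using a b uv convex_T_polyhedron[of n] unfolding Q_def convex_def by simp
    moreover have "u *\<^sub>R ?g a + v *\<^sub>R ?g b = ?g (u *\<^sub>R a + v *\<^sub>R b)"
    proof
      fix e
      have "u * y e + v * y e = y e" using uv(3) by (metis mult_1 distrib_right)
      then show "(u *\<^sub>R ?g a + v *\<^sub>R ?g b) e = ?g (u *\<^sub>R a + v *\<^sub>R b) e"
        by (simp add: algebra_simps)
    qed
    ultimately show "u *\<^sub>R a + v *\<^sub>R b \<in> Q" by (simp add: Q_def)
  qed
  moreover have "indicator F \<in> Q"
    if F: "one_tree n F" and even: "\<forall>S. S \<noteq> {} \<and> S \<subset> V\<^sub>K n \<and> card (cut_edges G S) = 4 \<and>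
      (\<forall>e\<in>cut_edges G S. x e = 1/2 \<and> e \<in> H) \<longrightarrow> even (card (F \<inter> cut_edges G S))" for F
  proof -
    let ?z = "\<lambda>e. y e + (if e \<in> G then 0 else indicator F e)"
    have FE: "F \<subseteq> E\<^sub>K n" using F by (simp add: one_tree_def)
    have "1 \<le> sum ?z (cut_edges (E\<^sub>K n) S)" if S: "S \<subseteq> V\<^sub>K n" "odd (card (cut_edges F S))" for S
    \<comment> \<open>Inside the support, an odd intersection with \<open>F\<close> excludes the
      exceptional four-edge cuts, so \<open>y_cut\<close> applies. Otherwise a single edge of
      \<open>F\<close> off the support already contributes 1 to \<open>?z\<close>.\<close>
    proof (cases "cut_edges F S \<subseteq> G")
      case True
      have "cut_edges F (V\<^sub>K n) = {}" "cut_edges F {} = {}"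
        using FE by (auto simp: cut_edges_def E\<^sub>K_def complete_edges_def Int_absorb2)
      then have S': "S \<noteq> {}" "S \<subset> V\<^sub>K n" using S by auto
      have "F \<inter> cut_edges G S = cut_edges F S" using True by (auto simp: cut_edges_def)
      then have "\<not> (card (cut_edges G S) = 4 \<and> (\<forall>e\<in>cut_edges G S. x e = 1/2 \<and> e \<in> H))"
        using even[rule_format, of S] S(2) S' by metis
      then have "1 \<le> sum y (cut_edges (E\<^sub>K n) S)" by (rule y_cut[OF S'])
      also have "\<dots> \<le> sum ?z (cut_edges (E\<^sub>K n) S)" by (intro sum_mono) (auto simp: indicator_def)
      finally show ?thesis .
    next
      case False
      then obtain e where e: "e \<in> cut_edges F S" "e \<notin> G" by blast
      have "1 \<le> ?z e" using e y_nonneg[of e] by (auto simp: cut_edges_def)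
      also have "?z e \<le> sum ?z (cut_edges (E\<^sub>K n) S)"
        using e FE finite_E\<^sub>K y_nonneg by (intro member_le_sum) (auto simp: cut_edges_def)
      finally show ?thesis .
    qed
    then have "(\<lambda>e. indicator F e + ?z e) \<in> T_polyhedron n"
      using FE one_tree_connected[OF F] y_nonneg y_out GE
      by (intro connected_plus_cut_dominator_in_T) (auto simp: indicator_def)
    then show ?thesis by (simp add: Q_def)
  qed
  ultimately have "convex hull {indicator F | F. one_tree n F \<and>
      (\<forall>S. S \<noteq> {} \<and> S \<subset> V\<^sub>K n \<and> card (cut_edges G S) = 4 \<and>
        (\<forall>e\<in>cut_edges G S. x e = 1/2 \<and> e \<in> H) \<longrightarrow> even (card (F \<inter> cut_edges G S)))} \<subseteq> Q"
    by (intro hull_minimal) blast+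
  then have "x \<in> Q" using B unfolding G_def by blast
  moreover have "(\<lambda>e. x e + (y e + (if e \<in> G then 0 else x e))) = (\<lambda>e. x e + y e)"
    using x_out by (auto simp: fun_eq_iff)
  ultimately have xy: "(\<lambda>e. x e + y e) \<in> T_polyhedron n" by (simp add: Q_def)
  \<comment> \<open>The Hamiltonian cycle is connected and even, so the empty join completes it to a
    tour.\<close>
  have "tour n (mset_set H + mset_set {})"
    using tour_mset_set_plus_join[of H n "{}"] vs(3) GE H_conn H_even by auto
  then have "multi_incidence (mset_set H) \<in> T_polyhedron n"
    using multi_incidence_in_T by force
  moreover have "multi_incidence (mset_set H) = indicator H"
    using fH by (auto simp: fun_eq_iff multi_incidence_def count_mset_set' indicator_def)
  ultimately have "(indicator H :: nat set \<Rightarrow> real) \<in> T_polyhedron n" by simp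
  then have "(6/7) *\<^sub>R (\<lambda>e. x e + y e) + (1/7) *\<^sub>R indicator H \<in> T_polyhedron n"
    using convexD[OF convex_T_polyhedron[of n] xy, of "indicator H" "6/7" "1/7"] by simp
  \<comment> \<open>The weights make the multiples of \<open>H\<close> cancel, as (6/7)(1/6) = 1/7,
    while \<open>x\<close> gets (6/7)(5/3) = 10/7.\<close>
  moreover have "(6/7) *\<^sub>R (\<lambda>e. x e + y e) + (1/7) *\<^sub>R indicator H = (10/7) *\<^sub>R x"
    by (auto simp: fun_eq_iff y_def field_simps)
  ultimately show ?thesis by simp
qed

end
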